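(* Let $n,r,t\ge 2$ be integers with $n\ge r+t$ and $r\ge t$. Let $p_t(n)$ be the number of different decompositions of the integer $n$ of the form $n=\sum_{i=1}^t p_i$ with integers $p_i\ge 2$ (the order of the summands being disregarded), and let $h_t(U_{n,r})$ be the number of different decompositions of $P(U_{n,r})$ into $t$ pieces. Then $$h_t(U_{n,r})\ge p_t(n).$$
   Context: $U_{n,r}$ is the uniform matroid of rank $r$ on $\{1,\dots,n\}$, whose bases are all $r$-subsets. For a matroid $M$ on $E=\{1,\dots,n\}$ with set of bases $\mathcal{B}(M)$, the matroid base polytope is $P(M)=\mathrm{conv}\{\sum_{i\in B}e_i : B\in\mathcal{B}(M)\}\subset\mathbb{R}^n$, where $e_i$ is the $i$-th standard basis vector. A decomposition of $P(M)$ into $t$ pieces (matroid base polytope decomposition) is an expression $P(M)=\bigcup_{i=1}^t P(M_i)$ where each $P(M_i)$ is the base polytope of a matroid $M_i$ on $E$, each $P(M_i)$ has the same dimension as $P(M)$, and for all $i\neq j$ the intersection $P(M_i)\cap P(M_j)$ is a face of both $P(M_i)$ and $P(M_j)$. Two decompositions $P(M)=\bigcup_{i=1}^tP(M_i)$ and $P(M)=\bigcup_{i=1}^tP(M'_i)$ are equivalent if there is a permutation $\sigma$ of $\{1,\dots,t\}$ such that $P(M_i)$ is combinatorially equivalent to $P(M'_{\sigma(i)})$ for every $i$; they are different otherwise. The number of different decompositions is the number of equivalence classes. *)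

theory Defs
  imports "HOL-Analysis.Analysis" "HOL-Combinatorics.Permutations" "HOL-Library.Multiset"
begin

text \<open>A matroid on a finite ground set is represented by its family of bases.\<close>

definition matroid_bases :: "'a set \<Rightarrow> 'a set set \<Rightarrow> bool" where
  "matroid_bases E \<B> \<longleftrightarrow>
     finite E \<and> \<B> \<noteq> {} \<and> \<B> \<subseteq> Pow E \<and>
     (\<forall>A\<in>\<B>. \<forall>B\<in>\<B>. \<forall>x\<in>A - B. \<exists>y\<in>B - A. insert y (A - {x}) \<in> \<B>)"

definition uniform_bases :: "'a set \<Rightarrow> nat \<Rightarrow> 'a set set" where
  "uniform_bases E r = {B. B \<subseteq> E \<and> card B = r}"

definition base_polytope :: "'n::finite set set \<Rightarrow> (real^'n) set" where
  "base_polytope \<B> = convex hull ((\<lambda>B. \<Sum>i\<in>B. axis i 1) ` \<B>)"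

text \<open>The relation \<open>face_of\<close> includes the empty face and the whole polytope. A subpolytope that is
  a face of full dimension is the whole polytope, so the only degenerate case that the face
  condition leaves open is that of two equal pieces (such as \<open>P = P \<union> P\<close>); it is excluded by
  requiring the pieces to be distinct.\<close>

definition base_decomposition ::
    "nat \<Rightarrow> 'n::finite set set \<Rightarrow> (nat \<Rightarrow> 'n set set) \<Rightarrow> bool" where
  "base_decomposition t \<B> M \<longleftrightarrow>
     M \<in> {1..t} \<rightarrow>\<^sub>E {\<C>. matroid_bases UNIV \<C>} \<and>
     base_polytope \<B> = (\<Union>i\<in>{1..t}. base_polytope (M i)) \<and>
     (\<forall>i\<in>{1..t}. aff_dim (base_polytope (M i)) = aff_dim (base_polytope \<B>)) \<and>
     (\<forall>i\<in>{1..t}. \<forall>j\<in>{1..t}. i \<noteq> j \<longrightarrow>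
        base_polytope (M i) \<noteq> base_polytope (M j) \<and>
        base_polytope (M i) \<inter> base_polytope (M j) face_of base_polytope (M i) \<and>
        base_polytope (M i) \<inter> base_polytope (M j) face_of base_polytope (M j))"

text \<open>Isomorphism of face lattices.\<close>

definition combinatorially_equivalent ::
    "'a::real_vector set \<Rightarrow> 'b::real_vector set \<Rightarrow> bool" where
  "combinatorially_equivalent P Q \<longleftrightarrow>
     (\<exists>f. bij_betw f {F. F face_of P} {G. G face_of Q} \<and>
          (\<forall>F F'. F face_of P \<longrightarrow> F' face_of P \<longrightarrow> (F \<subseteq> F' \<longleftrightarrow> f F \<subseteq> f F')))"

definition decomposition_equiv ::
    "nat \<Rightarrow> 'n::finite set set \<Rightarrow> ((nat \<Rightarrow> 'n set set) \<times> (nat \<Rightarrow> 'n set set)) set" where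
  "decomposition_equiv t \<B> =
     {(M, M'). base_decomposition t \<B> M \<and> base_decomposition t \<B> M' \<and>
        (\<exists>\<sigma>. \<sigma> permutes {1..t} \<and>
           (\<forall>i\<in>{1..t}. combinatorially_equivalent
              (base_polytope (M i)) (base_polytope (M' (\<sigma> i)))))}"

definition num_base_decompositions :: "nat \<Rightarrow> 'n::finite set set \<Rightarrow> nat" where
  "num_base_decompositions t \<B> = card ({M. base_decomposition t \<B> M} // decomposition_equiv t \<B>)"

definition num_partitions_ge2 :: "nat \<Rightarrow> nat \<Rightarrow> nat" where
  "num_partitions_ge2 t n = card {N :: nat multiset. size N = t \<and> (\<forall>p\<in>#N. 2 \<le> p) \<and> sum_mset N = n}"

text \<open>Sanity checks: the relation is an equivalence and both counted sets are finite, so neither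
  cardinality defaults to zero.\<close>

lemma combinatorially_equivalent_refl: "combinatorially_equivalent P P"
  unfolding combinatorially_equivalent_def by (intro exI[of _ id]) auto

lemma combinatorially_equivalent_sym:
  assumes "combinatorially_equivalent P Q" shows "combinatorially_equivalent Q P"
proof -
  obtain f where f: "bij_betw f {F. F face_of P} {G. G face_of Q}"
    and m: "\<And>F F'. F face_of P \<Longrightarrow> F' face_of P \<Longrightarrow> (F \<subseteq> F' \<longleftrightarrow> f F \<subseteq> f F')"
    using assms unfolding combinatorially_equivalent_def by blast
  let ?g = "inv_into {F. F face_of P} f"
  have g: "bij_betw ?g {G. G face_of Q} {F. F face_of P}" using f by (rule bij_betw_inv_into)
  have "G \<subseteq> G' \<longleftrightarrow> ?g G \<subseteq> ?g G'" if "G face_of Q" "G' face_of Q" for G G'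
  proof -
    have "?g G face_of P" "?g G' face_of P" using g that by (auto dest: bij_betwE)
    moreover have "f (?g G) = G" "f (?g G') = G'"
      using f that by (simp_all add: bij_betw_inv_into_right)
    ultimately show ?thesis using m by metis
  qed
  then show ?thesis using g unfolding combinatorially_equivalent_def by blast
qed

lemma combinatorially_equivalent_trans:
  assumes "combinatorially_equivalent P Q" "combinatorially_equivalent Q R"
  shows "combinatorially_equivalent P R"
proof -
  obtain f where f: "bij_betw f {F. F face_of P} {G. G face_of Q}"
    and mf: "\<And>F F'. F face_of P \<Longrightarrow> F' face_of P \<Longrightarrow> (F \<subseteq> F' \<longleftrightarrow> f F \<subseteq> f F')"
    using assms(1) unfolding combinatorially_equivalent_def by blast
  obtain g where g: "bij_betw g {F. F face_of Q} {G. G face_of R}"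
    and mg: "\<And>F F'. F face_of Q \<Longrightarrow> F' face_of Q \<Longrightarrow> (F \<subseteq> F' \<longleftrightarrow> g F \<subseteq> g F')"
    using assms(2) unfolding combinatorially_equivalent_def by blast
  have "f F face_of Q" if "F face_of P" for F using f that by (auto dest: bij_betwE)
  then have "\<forall>F F'. F face_of P \<longrightarrow> F' face_of P \<longrightarrow> (F \<subseteq> F' \<longleftrightarrow> (g \<circ> f) F \<subseteq> (g \<circ> f) F')"
    using mf mg by simp
  then show ?thesis
    using bij_betw_trans[OF f g] unfolding combinatorially_equivalent_def by blast
qed

lemma equiv_decomposition_equiv:
  "equiv {M. base_decomposition t \<B> M} (decomposition_equiv t \<B>)"
proof (intro equivI)
  show "decomposition_equiv t \<B> \<subseteq> {M. base_decomposition t \<B> M} \<times> {M. base_decomposition t \<B> M}"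
    unfolding decomposition_equiv_def by auto
  show "refl_on {M. base_decomposition t \<B> M} (decomposition_equiv t \<B>)"
  proof (rule refl_onI)
    fix M assume "M \<in> {M. base_decomposition t \<B> M}"
    then show "(M, M) \<in> decomposition_equiv t \<B>"
      unfolding decomposition_equiv_def
      by (auto intro!: exI[of _ id] permutes_id combinatorially_equivalent_refl)
  qed
  show "sym (decomposition_equiv t \<B>)"
  proof (rule symI)
    fix M M' assume "(M, M') \<in> decomposition_equiv t \<B>"
    then obtain \<sigma> where d: "base_decomposition t \<B> M" "base_decomposition t \<B> M'"
      and s: "\<sigma> permutes {1..t}"
      and c: "\<And>i. i \<in> {1..t} \<Longrightarrow>
        combinatorially_equivalent (base_polytope (M i)) (base_polytope (M' (\<sigma> i)))"
      unfolding decomposition_equiv_def by blast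
    have "combinatorially_equivalent (base_polytope (M' i)) (base_polytope (M (inv \<sigma> i)))"
      if "i \<in> {1..t}" for i
      using c[of "inv \<sigma> i"] permutes_in_image[OF permutes_inv[OF s], of i] that
        permutes_inverses(1)[OF s, of i]
      by (metis combinatorially_equivalent_sym)
    then show "(M', M) \<in> decomposition_equiv t \<B>"
      using d permutes_inv[OF s] unfolding decomposition_equiv_def by blast
  qed
  show "trans (decomposition_equiv t \<B>)"
  proof (rule transI)
    fix M M' M'' assume "(M, M') \<in> decomposition_equiv t \<B>" "(M', M'') \<in> decomposition_equiv t \<B>"
    then obtain \<sigma> \<tau> where d: "base_decomposition t \<B> M" "base_decomposition t \<B> M''"
      and s: "\<sigma> permutes {1..t}" "\<tau> permutes {1..t}"
      and c: "\<And>i. i \<in> {1..t} \<Longrightarrow>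
        combinatorially_equivalent (base_polytope (M i)) (base_polytope (M' (\<sigma> i)))"
        "\<And>i. i \<in> {1..t} \<Longrightarrow>
        combinatorially_equivalent (base_polytope (M' i)) (base_polytope (M'' (\<tau> i)))"
      unfolding decomposition_equiv_def by blast
    have "combinatorially_equivalent (base_polytope (M i)) (base_polytope (M'' ((\<tau> \<circ> \<sigma>) i)))"
      if "i \<in> {1..t}" for i
      using c(1)[OF that] c(2)[of "\<sigma> i"] permutes_in_image[OF s(1), of i] that
      by (auto intro: combinatorially_equivalent_trans)
    then show "(M, M'') \<in> decomposition_equiv t \<B>"
      using d permutes_compose[OF s] unfolding decomposition_equiv_def by blast
  qed
qed

lemma finite_base_decompositions:
  "finite {M :: nat \<Rightarrow> 'n::finite set set. base_decomposition t \<B> M}"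
proof (rule finite_subset)
  show "{M. base_decomposition t \<B> M} \<subseteq> {1..t} \<rightarrow>\<^sub>E (UNIV :: 'n set set set)"
    unfolding base_decomposition_def by (simp add: subset_iff PiE_iff)
  show "finite ({1..t} \<rightarrow>\<^sub>E (UNIV :: 'n set set set))"
    by (intro finite_PiE) auto
qed

lemma finite_base_decomposition_classes:
  "finite ({M. base_decomposition t \<B> M} // decomposition_equiv t \<B>)"
  using finite_base_decompositions
  by (rule finite_quotient) (auto simp: decomposition_equiv_def)

lemma finite_partitions_ge2:
  "finite {N :: nat multiset. size N = t \<and> (\<forall>p\<in>#N. 2 \<le> p) \<and> sum_mset N = n}"
proof (rule finite_subset)
  show "{N :: nat multiset. size N = t \<and> (\<forall>p\<in>#N. 2 \<le> p) \<and> sum_mset N = n}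
          \<subseteq> mset ` {xs. set xs \<subseteq> {..n} \<and> length xs = t}"
  proof
    fix N :: "nat multiset"
    assume N: "N \<in> {N. size N = t \<and> (\<forall>p\<in>#N. 2 \<le> p) \<and> sum_mset N = n}"
    obtain xs where xs: "mset xs = N" using ex_mset by blast
    have "set xs \<subseteq> {..n}"
      using N xs by (auto simp: sum_mset_sum_list member_le_sum_list)
    moreover have "length xs = t" using N xs by auto
    ultimately show "N \<in> mset ` {xs. set xs \<subseteq> {..n} \<and> length xs = t}" using xs by blast
  qed
  show "finite (mset ` {xs. set xs \<subseteq> {..n} \<and> length xs = t})"
    by (intro finite_imageI finite_lists_length_eq) simp
qed

lemma matroid_bases_uniform:
  assumes "finite E" "r \<le> card E"
  shows "matroid_bases E (uniform_bases E r)"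
  unfolding matroid_bases_def
proof (intro conjI ballI)
  show "finite E" by fact
  show "uniform_bases E r \<noteq> {}"
    using obtain_subset_with_card_n[OF assms(2)] unfolding uniform_bases_def by blast
  show "uniform_bases E r \<subseteq> Pow E" unfolding uniform_bases_def by auto
  fix A B x assume A: "A \<in> uniform_bases E r" and B: "B \<in> uniform_bases E r" and x: "x \<in> A - B"
  have fin: "finite A" "finite B" and c: "card A = card B"
    using A B assms(1) by (auto simp: uniform_bases_def intro: finite_subset)
  have "\<not> B \<subseteq> A" using card_subset_eq[OF fin(1), of B] c x by auto
  then obtain y where y: "y \<in> B - A" by blast
  have "card (insert y (A - {x})) = card A"
    using card_Suc_Diff1[OF fin(1), of x] fin x y by (simp del: card_Diff_insert card_Diff_singleton add: card_insert_disjoint)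
  then have "insert y (A - {x}) \<in> uniform_bases E r"
    using A B y by (auto simp: uniform_bases_def)
  with y show "\<exists>y\<in>B - A. insert y (A - {x}) \<in> uniform_bases E r" by blast
qed

end

theory Submission
  imports Defs
begin

text \<open>
  Passing from a matroid to its dual reflects base polytopes by \<open>x \<mapsto> 1 - x\<close> and exchanges the ranks
  \<open>r\<close> and \<open>n - r\<close>, so one may assume \<open>2 r \<le> n\<close>. For a subset \<open>A\<close> of the ground set write \<open>x(A)\<close> for
  the sum of the coordinates of \<open>x\<close> over \<open>A\<close>. A chain \<open>{} = A_0 \<subset> A_1 \<subset> \<dots> \<subset> A_t = UNIV\<close> cuts the
  hypersimplex, along the hyperplanes \<open>x(A_k) = 1\<close> with \<open>0 < k < t\<close>, into the \<open>t\<close> slabs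
  \<open>x(A_(j-1)) \<le> 1 \<le> x(A_j)\<close>. Two of these hyperplanes meet inside the hypersimplex only where the
  coordinates between the two sets vanish. They therefore do not cross in its interior, and the slabs
  fit together face to face (\<open>base_decomposition_nested\<close>). Every slab is the base polytope of a
  matroid: bounds on the sets of a chain define a matroid (\<open>matroid_bases_chain\<close>), and with integral
  bounds they cut out a polytope with integral vertices (\<open>base_polytope_chain_bases\<close>).

  Slabs are told apart by their number of facets. Facets are the maximal proper faces of a polytope,
  so combinatorial equivalence preserves their number. On the slab with index \<open>j\<close> the inequality
  \<open>x_i \<le> 1\<close> is implied by \<open>x(A_(j-1)) \<le> 1\<close> whenever \<open>i \<in> A_(j-1)\<close>. Hence a slab has
  \<open>2 n + 2 - card (A_(j-1))\<close> facets, up to corrections for the first and the last slab, for blocks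
  \<open>A_j - A_(j-1)\<close> of the least admissible size and for rank 2 (\<open>card_facets_nested\<close>). The numbers of
  facets of all slabs, in any order, still determine all the cardinalities \<open>card (A_k)\<close> (\<open>cut_sizes_determined\<close>).

  A partition \<open>p_1 \<le> \<dots> \<le> p_t\<close> of \<open>n\<close> into parts of size at least 2 gives the chain with
  \<open>card (A_k) = p_k + k - 1\<close> for \<open>0 < k < t\<close>, from which it can be read off. The chain is strictly
  increasing because the parts are sorted. Since \<open>p_(t-1) \<le> p_t\<close> and all other parts are at least 2,
  it satisfies \<open>2 card (A_(t-1)) \<le> n\<close>, so that \<open>2 r \<le> n\<close> leaves at least \<open>r\<close> elements outside of
  \<open>A_(t-1)\<close>, and each hyperplane really cuts the hypersimplex.
\<close>

section \<open>Matroids defined by a chain of rank bounds\<close>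

text \<open>A triple \<open>(A, l, u)\<close> bounds the number of elements of \<open>A\<close> in a basis from both sides. Bounds are
  attached to triples and not given by functions of \<open>A\<close>, because in the last slab of a decomposition
  the whole ground set carries two different pairs of bounds.\<close>

definition chain_bases :: "('a set \<times> nat \<times> nat) set \<Rightarrow> 'a set set" where
  "chain_bases K = {B. \<forall>(A, l, u)\<in>K. l \<le> card (B \<inter> A) \<and> card (B \<inter> A) \<le> u}"

definition chain_polytope :: "('n::finite set \<times> nat \<times> nat) set \<Rightarrow> (real^'n) set" where
  "chain_polytope K = {x. (\<forall>i. 0 \<le> x $ i \<and> x $ i \<le> 1) \<and>
     (\<forall>(A, l, u)\<in>K. real l \<le> (\<Sum>i\<in>A. x $ i) \<and> (\<Sum>i\<in>A. x $ i) \<le> real u)}"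

definition chain_constraints :: "('a set \<times> nat \<times> nat) set \<Rightarrow> nat \<Rightarrow> bool" where
  "chain_constraints K r \<longleftrightarrow> (UNIV, r, r) \<in> K \<and> (\<forall>c\<in>K. \<forall>d\<in>K. fst c \<subseteq> fst d \<or> fst d \<subseteq> fst c)"

lemma chain_least:
  assumes "finite \<A>" "S \<in> \<A>" "\<And>A B. A \<in> \<A> \<Longrightarrow> B \<in> \<A> \<Longrightarrow> A \<subseteq> B \<or> B \<subseteq> (A :: 'a set)"
  obtains L where "L \<in> \<A>" "\<And>A. A \<in> \<A> \<Longrightarrow> L \<subseteq> A"
proof -
  have "\<A> \<noteq> {}" using assms(2) by blast
  from finite_has_minimal[OF assms(1) this] obtain L
    where L: "L \<in> \<A>" "\<And>A. A \<in> \<A> \<Longrightarrow> A \<subseteq> L \<Longrightarrow> L = A" by blast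
  have "L \<subseteq> A" if "A \<in> \<A>" for A using assms(3)[OF L(1) that] L(2)[OF that] by blast
  then show thesis using L(1) that by blast
qed

lemma chain_greatest:
  assumes "finite \<A>" "S \<in> \<A>" "\<And>A B. A \<in> \<A> \<Longrightarrow> B \<in> \<A> \<Longrightarrow> A \<subseteq> B \<or> B \<subseteq> (A :: 'a set)"
  obtains U where "U \<in> \<A>" "\<And>A. A \<in> \<A> \<Longrightarrow> A \<subseteq> U"
proof -
  have "\<A> \<noteq> {}" using assms(2) by blast
  from finite_has_maximal[OF assms(1) this] obtain U
    where U: "U \<in> \<A>" "\<And>A. A \<in> \<A> \<Longrightarrow> U \<subseteq> A \<Longrightarrow> U = A" by blast
  have "A \<subseteq> U" if "A \<in> \<A>" for A using assms(3)[OF U(1) that] U(2)[OF that] by blast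
  then show thesis using U(1) that by blast
qed

lemma card_swap:
  assumes "finite A" "x \<in> A" "y \<notin> A"
  shows "card (insert y (A - {x})) = card A"
proof -
  have "card (insert y (A - {x})) = Suc (card (A - {x}))" using assms by (intro card_insert_disjoint) auto
  then show ?thesis using card_Suc_Diff1[OF assms(1,2)] by simp
qed

text \<open>Let \<open>x \<in> X - Y\<close>, let \<open>L\<close> be the least set of the chain that contains \<open>x\<close> and attains its lower bound
  in \<open>X\<close>, and let \<open>V\<close> be the greatest one that avoids \<open>x\<close> and attains its upper bound (or \<open>V = {}\<close>). An element of
  \<open>Y - X\<close> can replace \<open>x\<close> as soon as it lies in \<open>L - V\<close>. There is one, because \<open>Y\<close> has at least as many
  elements in \<open>L\<close> as \<open>X\<close>, and at most as many in \<open>V\<close>.\<close>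

lemma matroid_bases_chain:
  fixes K :: "('a::finite set \<times> nat \<times> nat) set"
  assumes K: "chain_constraints K r" and ne: "chain_bases K \<noteq> {}"
  shows "matroid_bases UNIV (chain_bases K)"
  unfolding matroid_bases_def
proof (intro conjI ballI)
  show "finite (UNIV :: 'a set)" by simp
  show "chain_bases K \<noteq> {}" by (fact ne)
  show "chain_bases K \<subseteq> Pow UNIV" by simp
  fix X Y x assume X: "X \<in> chain_bases K" and Y: "Y \<in> chain_bases K" and x: "x \<in> X - Y"
  have bd: "l \<le> card (Z \<inter> A)" "card (Z \<inter> A) \<le> u" if "(A, l, u) \<in> K" "Z = X \<or> Z = Y" for A l u Z
    using X Y that unfolding chain_bases_def by auto
  have nest: "A \<subseteq> A' \<or> A' \<subseteq> A" if "(A, l, u) \<in> K" "(A', l', u') \<in> K" for A l u A' l' u'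
    using K that unfolding chain_constraints_def by force
  have U: "(UNIV, r, r) \<in> K" using K by (simp add: chain_constraints_def)
  define \<L> where "\<L> = {A. \<exists>l u. (A, l, u) \<in> K \<and> x \<in> A \<and> card (X \<inter> A) = l}"
  define \<U> where "\<U> = insert {} {A. \<exists>l u. (A, l, u) \<in> K \<and> x \<notin> A \<and> card (X \<inter> A) = u}"
  have "UNIV \<in> \<L>" using U bd[OF U, of X] by (auto simp: \<L>_def intro!: exI[of _ r] le_antisym)
  moreover have "A \<subseteq> B \<or> B \<subseteq> A" if "A \<in> \<L>" "B \<in> \<L>" for A B
    using that nest unfolding \<L>_def by blast
  ultimately obtain L where L: "L \<in> \<L>" and Lmin: "\<And>A. A \<in> \<L> \<Longrightarrow> L \<subseteq> A"
    using chain_least[of \<L> UNIV] by (metis finite)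
  have "A \<subseteq> B \<or> B \<subseteq> A" if "A \<in> \<U>" "B \<in> \<U>" for A B
    using that nest unfolding \<U>_def by blast
  moreover have "{} \<in> \<U>" by (simp add: \<U>_def)
  ultimately obtain V where V: "V \<in> \<U>" and Vmax: "\<And>A. A \<in> \<U> \<Longrightarrow> A \<subseteq> V"
    using chain_greatest[of \<U> "{}"] by (metis finite)
  have VL: "V \<subseteq> L" and xLV: "x \<in> L - V" using V L nest unfolding \<U>_def \<L>_def by blast+
  have "card (X \<inter> L) \<le> card (Y \<inter> L)" using L bd unfolding \<L>_def by force
  moreover have "card (Y \<inter> V) \<le> card (X \<inter> V)" using V bd unfolding \<U>_def by force
  moreover have split: "card (Z \<inter> L) = card (Z \<inter> V) + card (Z \<inter> (L - V))" for Z
    using VL by (subst card_Un_disjoint[symmetric]) (auto intro!: arg_cong[where f = card])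
  ultimately have le: "card (X \<inter> (L - V)) \<le> card (Y \<inter> (L - V))" by (simp only: split)
  have "\<not> Y \<inter> (L - V) \<subseteq> X"
  proof
    assume "Y \<inter> (L - V) \<subseteq> X"
    then have "Y \<inter> (L - V) \<subset> X \<inter> (L - V)" using x xLV by blast
    then show False using le psubset_card_mono[of "X \<inter> (L - V)" "Y \<inter> (L - V)"] by simp
  qed
  then obtain y where y: "y \<in> Y - X" "y \<in> L" "y \<notin> V" by blast
  have "insert y (X - {x}) \<in> chain_bases K"
    unfolding chain_bases_def
  proof (clarify)
    fix A l u assume A: "(A, l, u) \<in> K"
    let ?Z = "insert y (X - {x}) \<inter> A"
    consider "x \<in> A" "y \<in> A" | "x \<notin> A" "y \<notin> A" | "x \<in> A" "y \<notin> A" | "x \<notin> A" "y \<in> A" by blast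
    then show "l \<le> card ?Z \<and> card ?Z \<le> u"
    proof cases
      case 1
      then have "?Z = insert y (X \<inter> A - {x})" by auto
      then have "card ?Z = card (X \<inter> A)" using 1 x y by (simp only:) (rule card_swap; auto)
      then show ?thesis using bd[OF A] by simp
    next
      case 2
      then have "?Z = X \<inter> A" by auto
      then show ?thesis using bd[OF A] by simp
    next
      case 3
      then have "?Z = X \<inter> A - {x}" by auto
      then have "card ?Z = card (X \<inter> A) - 1" using 3 x by simp
      moreover have "card (X \<inter> A) \<noteq> l" using Lmin[of A] 3 y A unfolding \<L>_def by blast
      ultimately show ?thesis using bd[OF A, of X] by auto
    next
      case 4
      then have "?Z = insert y (X \<inter> A)" by auto
      then have "card ?Z = card (X \<inter> A) + 1" using 4 y by simp
      moreover have "card (X \<inter> A) \<noteq> u" using Vmax[of A] 4 y A unfolding \<U>_def by blast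
      ultimately show ?thesis using bd[OF A, of X] by simp
    qed
  qed
  with y show "\<exists>y\<in>Y - X. insert y (X - {x}) \<in> chain_bases K" by blast
qed

lemma sum_axis_nth: "(\<Sum>i\<in>B. axis i 1 :: real^'n::finite) $ k = (if k \<in> B then 1 else 0)"
  by (simp add: axis_def if_distrib cong: if_cong)

lemma sum_sum_axis: "(\<Sum>k\<in>A. (\<Sum>i\<in>B. axis i 1 :: real^'n::finite) $ k) = card (B \<inter> A)"
  by (simp only: sum_axis_nth) (simp add: sum.If_cases Int_commute)

lemma chain_polytope_halfspaces:
  "chain_polytope K = (\<Inter>i. {x. axis i 1 \<bullet> x \<ge> 0}) \<inter> (\<Inter>i. {x. axis i 1 \<bullet> x \<le> 1}) \<inter>
     ((\<Inter>(A, l, u)\<in>K. {x. (\<Sum>i\<in>A. axis i 1) \<bullet> x \<ge> real l}) \<inter>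
      (\<Inter>(A, l, u)\<in>K. {x. (\<Sum>i\<in>A. axis i 1) \<bullet> x \<le> real u}))"
  unfolding chain_polytope_def by (auto simp: inner_axis inner_axis' inner_sum_left)

lemma convex_chain_polytope: "convex (chain_polytope K)"
  unfolding chain_polytope_halfspaces
  by (intro convex_Int convex_INT) (auto simp: convex_halfspace_le convex_halfspace_ge)

lemma compact_chain_polytope: "compact (chain_polytope K)"
proof -
  have "closed (chain_polytope K)"
    unfolding chain_polytope_halfspaces
    by (intro closed_Int closed_INT) (auto simp: closed_halfspace_le closed_halfspace_ge)
  moreover have "chain_polytope K \<subseteq> cbox 0 1"
    by (auto simp: chain_polytope_def mem_box_cart)
  ultimately show ?thesis by (metis bounded_cbox bounded_subset compact_eq_bounded_closed)
qed

lemma indicator_in_chain_polytope_iff: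
  "(\<Sum>i\<in>B. axis i 1) \<in> chain_polytope K \<longleftrightarrow> B \<in> chain_bases K"
  unfolding chain_polytope_def chain_bases_def
  by (auto simp only: mem_Collect_eq sum_sum_axis sum_axis_nth of_nat_le_iff split: if_splits prod.splits)

text \<open>Suppose that some coordinate is not an integer. Among the sets of the chain with an integral
  coordinate sum and a fractional coordinate, a least one \<open>L\<close> has at least two fractional
  coordinates \<open>j\<close> and \<open>k\<close>. A set of the chain that separates \<open>j\<close> from \<open>k\<close> has a fractional sum and so
  is away from its bounds. Moving along \<open>axis j 1 - axis k 1\<close> in either direction therefore stays
  inside the polytope.\<close>

lemma extreme_point_chain_polytope_Ints:
  fixes K :: "('n::finite set \<times> nat \<times> nat) set"
  assumes K: "chain_constraints K r" and x: "x extreme_point_of chain_polytope K"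
  shows "x $ i \<in> \<int>"
proof (rule ccontr)
  assume i: "x $ i \<notin> \<int>"
  have xP: "x \<in> chain_polytope K"
    and ext: "\<And>a b. a \<in> chain_polytope K \<Longrightarrow> b \<in> chain_polytope K \<Longrightarrow> x \<notin> open_segment a b"
    using x unfolding extreme_point_of_def by auto
  have U: "(UNIV, r, r) \<in> K" using K by (simp add: chain_constraints_def)
  define s where "s A = (\<Sum>k\<in>A. x $ k)" for A
  have bd: "real l \<le> s A" "s A \<le> real u" if "(A, l, u) \<in> K" for A l u
    using xP that unfolding chain_polytope_def s_def by auto
  define frac_in where "frac_in A \<longleftrightarrow> (\<exists>k\<in>A. x $ k \<notin> \<int>)" for A
  define \<L> where "\<L> = {A \<in> fst ` K. s A \<in> \<int> \<and> frac_in A}"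
  have "s UNIV = real r" using bd[OF U] by simp
  then have "UNIV \<in> \<L>" using imageI[OF U, of fst] i unfolding \<L>_def frac_in_def by auto
  moreover have "A \<subseteq> B \<or> B \<subseteq> A" if "A \<in> \<L>" "B \<in> \<L>" for A B
    using that K unfolding chain_constraints_def \<L>_def by auto
  ultimately obtain L where L: "L \<in> \<L>" and Lmin: "\<And>A. A \<in> \<L> \<Longrightarrow> L \<subseteq> A"
    using chain_least[of \<L> UNIV] by (metis finite)
  obtain j where j: "j \<in> L" "x $ j \<notin> \<int>" using L by (auto simp: \<L>_def frac_in_def)
  have "\<exists>k\<in>L - {j}. x $ k \<notin> \<int>"
  proof (rule ccontr)
    assume "\<not> ?thesis"
    then have "(\<Sum>k\<in>L - {j}. x $ k) \<in> \<int>" by (intro Ints_sum) auto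
    moreover have "s L = x $ j + (\<Sum>k\<in>L - {j}. x $ k)" using j by (simp add: s_def sum.remove)
    ultimately show False using L j Ints_diff[of "s L" "\<Sum>k\<in>L - {j}. x $ k"] by (auto simp: \<L>_def)
  qed
  then obtain k where k: "k \<in> L" "k \<noteq> j" "x $ k \<notin> \<int>" by blast
  have sep: "s A \<notin> \<int>" if A: "A \<in> fst ` K" and "(j \<in> A) \<noteq> (k \<in> A)" for A
  proof
    assume "s A \<in> \<int>"
    moreover have "frac_in A" using that j k unfolding frac_in_def by auto
    ultimately have "L \<subseteq> A" using Lmin A unfolding \<L>_def by blast
    then show False using that j k by auto
  qed
  \<comment> \<open>The fractional quantities that change along the move; \<open>\<epsilon>\<close> is their least distance to an integer.\<close>
  define T where "T = insert (x $ j) (insert (x $ k) (s ` {A \<in> fst ` K. s A \<notin> \<int>}))"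
  define \<epsilon> where "\<epsilon> = Min ((\<lambda>v. min (frac v) (1 - frac v)) ` T)"
  have finT: "finite T" "T \<noteq> {}" unfolding T_def by auto
  have "v \<notin> \<int>" if "v \<in> T" for v using that j k unfolding T_def by auto
  then have "0 < min (frac v) (1 - frac v)" if "v \<in> T" for v
    using that frac_gt_0_iff[of v] frac_lt_1[of v] by auto
  then have \<epsilon>0: "\<epsilon> > 0" unfolding \<epsilon>_def using finT by (subst Min_gr_iff) auto
  have \<epsilon>le: "\<epsilon> \<le> frac v \<and> \<epsilon> \<le> 1 - frac v" if "v \<in> T" for v
    using Min_le[of "(\<lambda>v. min (frac v) (1 - frac v)) ` T" "min (frac v) (1 - frac v)"] that finT
    unfolding \<epsilon>_def by auto
  have room: "of_int m \<le> v - \<epsilon>" "v + \<epsilon> \<le> of_int p"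
    if "v \<in> T" "of_int m \<le> v" "v \<le> of_int p" for v and m p :: int
  proof -
    have "m \<le> \<lfloor>v\<rfloor>" using that by (simp add: le_floor_iff)
    moreover have "p > \<lfloor>v\<rfloor>"
    proof (rule ccontr)
      assume "\<not> p > \<lfloor>v\<rfloor>"
      then have "v \<le> of_int \<lfloor>v\<rfloor>" using that by linarith
      then have "frac v \<le> 0" by (simp add: frac_def)
      then show False using \<epsilon>le[OF that(1)] \<epsilon>0 by linarith
    qed
    ultimately have "of_int m \<le> real_of_int \<lfloor>v\<rfloor>" "real_of_int \<lfloor>v\<rfloor> + 1 \<le> of_int p" by linarith+
    then show "of_int m \<le> v - \<epsilon>" "v + \<epsilon> \<le> of_int p"
      using \<epsilon>le[OF that(1)] unfolding frac_def by linarith+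
  qed
  define d :: "real^'n" where "d = axis j 1 - axis k 1"
  have d_nth: "d $ i = (if i = j then 1 else if i = k then -1 else 0)" for i
    using k by (auto simp: d_def axis_def)
  have sum_d: "(\<Sum>i\<in>A. d $ i) = (if j \<in> A then 1 else 0) - (if k \<in> A then 1 else 0)" for A
    by (simp add: d_def sum_subtractf axis_def)
  have mv: "x + c *\<^sub>R d \<in> chain_polytope K" if c: "c = \<epsilon> \<or> c = - \<epsilon>" for c
    unfolding chain_polytope_def
  proof (clarify, intro conjI allI ballI, safe)
    fix i
    have b: "0 \<le> x $ i" "x $ i \<le> 1" using xP unfolding chain_polytope_def by auto
    have "of_int 0 \<le> x $ i - \<epsilon> \<and> x $ i + \<epsilon> \<le> of_int 1" if "i = j \<or> i = k"
      using that room[of "x $ i" 0 1] b unfolding T_def by auto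
    then show "0 \<le> (x + c *\<^sub>R d) $ i" "(x + c *\<^sub>R d) $ i \<le> 1"
      using b c \<epsilon>0 by (auto simp: d_nth split: if_splits)
  next
    fix A l u assume A: "(A, l, u) \<in> K"
    have e: "(\<Sum>i\<in>A. (x + c *\<^sub>R d) $ i) = s A + c * (\<Sum>i\<in>A. d $ i)"
      by (simp add: sum.distrib s_def sum_distrib_left)
    have "real l \<le> s A - \<epsilon> \<and> s A + \<epsilon> \<le> real u" if "(j \<in> A) \<noteq> (k \<in> A)"
    proof -
      have "s A \<in> T" using sep[of A] that A unfolding T_def by force
      then show ?thesis using room[of "s A" "int l" "int u"] bd[OF A] by simp
    qed
    then have "real l \<le> s A + c * (\<Sum>i\<in>A. d $ i) \<and> s A + c * (\<Sum>i\<in>A. d $ i) \<le> real u"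
      using bd[OF A] c \<epsilon>0 unfolding sum_d by auto
    then show "real l \<le> (\<Sum>i\<in>A. (x + c *\<^sub>R d) $ i)" "(\<Sum>i\<in>A. (x + c *\<^sub>R d) $ i) \<le> real u"
      unfolding e by auto
  qed
  have "x \<in> open_segment (x + \<epsilon> *\<^sub>R d) (x + (- \<epsilon>) *\<^sub>R d)"
    unfolding in_segment
  proof (intro conjI exI[of _ "1/2"])
    show "x + \<epsilon> *\<^sub>R d \<noteq> x + (- \<epsilon>) *\<^sub>R d"
    proof
      assume "x + \<epsilon> *\<^sub>R d = x + (- \<epsilon>) *\<^sub>R d"
      then have "(x + \<epsilon> *\<^sub>R d) $ j = (x + (- \<epsilon>) *\<^sub>R d) $ j" by (rule arg_cong)
      then show False using \<epsilon>0 by (simp add: d_nth)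
    qed
    show "x = (1 - 1 / 2) *\<^sub>R (x + \<epsilon> *\<^sub>R d) + (1 / 2) *\<^sub>R (x + (- \<epsilon>) *\<^sub>R d)"
      by (rule vec_eq_iff[THEN iffD2]) (simp add: field_simps)
  qed auto
  then show False using ext mv by blast
qed

text \<open>The theorem of Krein and Milman reduces this to the integrality of the extreme points, since the
  0/1 vectors in the polytope are the indicator vectors of the bases.\<close>

lemma base_polytope_chain_bases:
  fixes K :: "('n::finite set \<times> nat \<times> nat) set"
  assumes K: "chain_constraints K r"
  shows "base_polytope (chain_bases K) = chain_polytope K"
proof
  show "base_polytope (chain_bases K) \<subseteq> chain_polytope K"
    unfolding base_polytope_def
    by (intro hull_minimal convex_chain_polytope) (auto simp: indicator_in_chain_polytope_iff)
  have "x \<in> (\<lambda>B. \<Sum>i\<in>B. axis i 1) ` chain_bases K" if x: "x extreme_point_of chain_polytope K" for x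
  proof -
    define B where "B = {i. x $ i = 1}"
    have "x $ i = 0 \<or> x $ i = 1" for i
    proof -
      obtain m where m: "x $ i = of_int m"
        using extreme_point_chain_polytope_Ints[OF K x, of i] by (elim Ints_cases)
      moreover have "0 \<le> x $ i" "x $ i \<le> 1"
        using x by (auto simp: extreme_point_of_def chain_polytope_def)
      ultimately show ?thesis by auto
    qed
    then have "x = (\<Sum>i\<in>B. axis i 1)" unfolding vec_eq_iff sum_axis_nth B_def by auto
    moreover have "x \<in> chain_polytope K" using x by (simp add: extreme_point_of_def)
    ultimately show ?thesis using indicator_in_chain_polytope_iff by blast
  qed
  then show "chain_polytope K \<subseteq> base_polytope (chain_bases K)"
    unfolding base_polytope_def
    by (subst Krein_Milman_Minkowski[OF compact_chain_polytope convex_chain_polytope])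
       (intro hull_mono, blast)
qed

section \<open>Facets of a polytope given by inequalities\<close>

text \<open>The facets of a polytope, described by means of its face lattice alone.\<close>

definition maximal_proper_faces :: "'a::real_vector set \<Rightarrow> 'a set set" where
  "maximal_proper_faces P =
     {F. F face_of P \<and> F \<noteq> P \<and> (\<forall>G. G face_of P \<and> F \<subseteq> G \<longrightarrow> G = F \<or> G = P)}"

lemma card_maximal_proper_faces_combinatorially_equivalent:
  assumes PQ: "combinatorially_equivalent P Q" and conv: "convex P" "convex Q"
  shows "card (maximal_proper_faces P) = card (maximal_proper_faces Q)"
proof -
  obtain f where f: "bij_betw f {F. F face_of P} {G. G face_of Q}"
    and mono: "\<And>F F'. F face_of P \<Longrightarrow> F' face_of P \<Longrightarrow> (F \<subseteq> F' \<longleftrightarrow> f F \<subseteq> f F')"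
    using PQ unfolding combinatorially_equivalent_def by blast
  have fQ: "f F face_of Q" if "F face_of P" for F using f that by (auto dest: bij_betwE)
  have surj: "\<exists>F. F face_of P \<and> G = f F" if "G face_of Q" for G
    using f that unfolding bij_betw_def by blast
  have inj: "f F = f F' \<longleftrightarrow> F = F'" if "F face_of P" "F' face_of P" for F F'
    by (simp only: set_eq_subset mono[OF that] mono[OF that(2,1)])
  have PP: "P face_of P" and QQ: "Q face_of Q" using conv by (simp_all add: face_of_refl)
  have fP: "f P = Q"
  proof
    show "f P \<subseteq> Q" using fQ[OF PP] by (simp add: face_of_imp_subset)
    obtain F where F: "F face_of P" "Q = f F" using surj[OF QQ] by blast
    show "Q \<subseteq> f P" using mono[OF F(1) PP] face_of_imp_subset[OF F(1)] F(2) by simp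
  qed
  have iff: "f F \<in> maximal_proper_faces Q \<longleftrightarrow> F \<in> maximal_proper_faces P" if F: "F face_of P" for F
  proof -
    have "f F \<noteq> Q \<longleftrightarrow> F \<noteq> P" using inj[OF F PP] fP by simp
    moreover have "(\<forall>G. G face_of Q \<and> f F \<subseteq> G \<longrightarrow> G = f F \<or> G = Q) \<longleftrightarrow>
        (\<forall>G. G face_of P \<and> F \<subseteq> G \<longrightarrow> G = F \<or> G = P)" (is "?L \<longleftrightarrow> ?R")
    proof
      assume L: ?L
      show ?R
      proof (intro allI impI)
        fix G assume G: "G face_of P \<and> F \<subseteq> G"
        then have "f G = f F \<or> f G = Q" using L fQ mono[OF F, of G] by blast
        then show "G = F \<or> G = P" using G inj[of G F] inj[of G P] F PP fP by simp
      qed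
    next
      assume R: ?R
      show ?L
      proof (intro allI impI)
        fix G' assume G': "G' face_of Q \<and> f F \<subseteq> G'"
        then obtain G where G: "G face_of P" "G' = f G" using surj by blast
        then have "G = F \<or> G = P" using R G' mono[OF F, of G] by blast
        then show "G' = f F \<or> G' = Q" using G fP by blast
      qed
    qed
    ultimately show ?thesis using F fQ[OF F] unfolding maximal_proper_faces_def by simp
  qed
  have "bij_betw f (maximal_proper_faces P) (maximal_proper_faces Q)"
  proof (rule bij_betw_subset[OF f])
    show "maximal_proper_faces P \<subseteq> {F. F face_of P}" by (auto simp: maximal_proper_faces_def)
    show "f ` maximal_proper_faces P = maximal_proper_faces Q"
    proof
      show "f ` maximal_proper_faces P \<subseteq> maximal_proper_faces Q"
      proof
        fix G assume "G \<in> f ` maximal_proper_faces P"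
        then obtain F where "F \<in> maximal_proper_faces P" "G = f F" by blast
        moreover have "F face_of P" using calculation by (simp add: maximal_proper_faces_def)
        ultimately show "G \<in> maximal_proper_faces Q" using iff by simp
      qed
      show "maximal_proper_faces Q \<subseteq> f ` maximal_proper_faces P"
      proof
        fix G assume G: "G \<in> maximal_proper_faces Q"
        then have "G face_of Q" by (simp add: maximal_proper_faces_def)
        then obtain F where "F face_of P" "G = f F" using surj by blast
        then show "G \<in> f ` maximal_proper_faces P" using iff G by blast
      qed
    qed
  qed
  then show ?thesis by (rule bij_betw_same_card)
qed

text \<open>Otherwise \<open>F\<close> contains, for every inequality, a point at which it is strict. The average of these
  points satisfies all of them strictly, so that it lies in the relative interior of \<open>P\<close>, and a face
  with such a point is all of \<open>P\<close>.\<close>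

lemma proper_face_subset_tight:
  fixes a :: "'k \<Rightarrow> 'a::euclidean_space"
  assumes I: "finite I" "I \<noteq> {}"
    and P: "P = {x. c \<bullet> x = d \<and> (\<forall>k\<in>I. a k \<bullet> x \<le> b k)}"
    and F: "F face_of P" "F \<noteq> P" "F \<noteq> {}"
  shows "\<exists>k\<in>I. F \<subseteq> P \<inter> {x. a k \<bullet> x = b k}"
proof (rule ccontr)
  assume no: "\<not> ?thesis"
  have FP: "F \<subseteq> P" and cF: "convex F" using F by (auto simp: face_of_imp_subset face_of_imp_convex)
  have "\<forall>k\<in>I. \<exists>y\<in>F. a k \<bullet> y < b k"
  proof
    fix k assume k: "k \<in> I"
    then obtain y where "y \<in> F" "a k \<bullet> y \<noteq> b k" using no FP by blast
    moreover have "a k \<bullet> y \<le> b k" using calculation FP k P by blast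
    ultimately show "\<exists>y\<in>F. a k \<bullet> y < b k" by (auto intro: bexI[of _ y])
  qed
  then obtain y where y: "\<And>k. k \<in> I \<Longrightarrow> y k \<in> F" "\<And>k. k \<in> I \<Longrightarrow> a k \<bullet> y k < b k" by metis
  define N where "N = real (card I)"
  have N: "N > 0" using I by (simp add: N_def card_gt_0_iff)
  define z where "z = (\<Sum>k\<in>I. (1 / N) *\<^sub>R y k)"
  have zF: "z \<in> F" unfolding z_def
    using I N y cF by (intro convex_sum) (auto simp: N_def)
  have zP: "z \<in> P" using zF FP by blast
  have zlt: "a k \<bullet> z < b k" if k: "k \<in> I" for k
  proof -
    have "a k \<bullet> z = (\<Sum>j\<in>I. (1 / N) * (a k \<bullet> y j))" by (simp add: z_def inner_sum_right)
    also have "\<dots> < (\<Sum>j\<in>I. (1 / N) * b k)"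
    proof (rule sum_strict_mono_ex1)
      show "\<forall>j\<in>I. (1 / N) * (a k \<bullet> y j) \<le> (1 / N) * b k"
      proof (intro ballI mult_left_mono)
        fix j assume "j \<in> I"
        then have "y j \<in> P" using y FP by blast
        then show "a k \<bullet> y j \<le> b k" using k unfolding P by blast
      qed (use N in simp)
      show "\<exists>j\<in>I. (1 / N) * (a k \<bullet> y j) < (1 / N) * b k"
        using y(2)[OF k] k N by (intro bexI[of _ k]) (auto intro: divide_strict_right_mono)
    qed (use I in auto)
    also have "\<dots> = b k" using I by (simp add: N_def)
    finally show ?thesis .
  qed
  have "P \<subseteq> F"
  proof
    fix p assume p: "p \<in> P"
    show "p \<in> F"
    proof (cases "p = z")
      case True then show ?thesis using zF by simp
    next
      case False
      have "\<forall>\<^sub>F e in at_right 0. a k \<bullet> (z + e *\<^sub>R (z - p)) < b k" if "k \<in> I" for k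
      proof -
        have "((\<lambda>e. a k \<bullet> (z + e *\<^sub>R (z - p))) \<longlongrightarrow> a k \<bullet> (z + 0 *\<^sub>R (z - p))) (at_right 0)"
          by (intro tendsto_intros)
        then show ?thesis using zlt[OF that] by (auto dest: order_tendstoD(2))
      qed
      then have "\<forall>\<^sub>F e in at_right 0. \<forall>k\<in>I. a k \<bullet> (z + e *\<^sub>R (z - p)) < b k"
        using I by (intro eventually_ball_finite) auto
      then have "\<forall>\<^sub>F e in at_right 0. e > 0 \<and> (\<forall>k\<in>I. a k \<bullet> (z + e *\<^sub>R (z - p)) < b k)"
        by (rule eventually_conj[OF eventually_at_right_less])
      from eventually_happens'[OF trivial_limit_at_right_real this] obtain e
        where e: "e > 0" "\<And>k. k \<in> I \<Longrightarrow> a k \<bullet> (z + e *\<^sub>R (z - p)) < b k" by blast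
      define q where "q = z + e *\<^sub>R (z - p)"
      have cz: "c \<bullet> z = d" "c \<bullet> p = d" using zP p P by auto
      have "c \<bullet> q = d" by (simp add: q_def inner_add_right inner_diff_right cz)
      then have "q \<in> P" using e(2) unfolding P q_def by (auto intro: less_imp_le)
      moreover have "z \<in> open_segment p q"
        unfolding in_segment
      proof (intro conjI exI[of _ "1 / (1 + e)"])
        have "q - p = (1 + e) *\<^sub>R (z - p)" by (simp add: q_def algebra_simps)
        then have "q - p \<noteq> 0" using False e by simp
        then show "p \<noteq> q" by simp
        have "(1 - u) *\<^sub>R p + u *\<^sub>R q = p + u *\<^sub>R (q - p)" for u :: real
          by (simp add: scaleR_diff_left scaleR_diff_right)
        then show "z = (1 - 1 / (1 + e)) *\<^sub>R p + (1 / (1 + e)) *\<^sub>R q"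
          unfolding \<open>q - p = _\<close> using e(1) by simp
        show "0 < 1 / (1 + e)" "1 / (1 + e) < 1" using e(1) by simp_all
      qed
      ultimately have "p \<in> F \<and> q \<in> F" using face_ofD[OF F(1) _ p _ zF] by blast
      then show ?thesis by simp
    qed
  qed
  then show False using FP F(2) by blast
qed

text \<open>Every proper face lies in a face defined by one tight inequality. If the inequalities in \<open>J\<close> are
  irredundant, in the sense that each of them can be tight on its own among \<open>J\<close>, and if tightness of
  any other inequality forces one of \<open>J\<close> to be tight, then the faces belonging to \<open>J\<close> are proper, pairwise
  incomparable, and every proper face lies in one of them. So they are the maximal proper faces.\<close>

lemma card_maximal_proper_faces:
  fixes a :: "'k \<Rightarrow> 'a::euclidean_space"
  assumes I: "finite I" "J \<subseteq> I" "J \<noteq> {}"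
    and P: "P = {x. c \<bullet> x = d \<and> (\<forall>k\<in>I. a k \<bullet> x \<le> b k)}"
    and strict: "\<And>k. k \<in> J \<Longrightarrow> \<exists>x\<in>P. a k \<bullet> x < b k"
    and tight: "\<And>k. k \<in> J \<Longrightarrow> \<exists>x\<in>P. a k \<bullet> x = b k \<and> (\<forall>l\<in>J - {k}. a l \<bullet> x < b l)"
    and redundant: "\<And>k. k \<in> I - J \<Longrightarrow> \<exists>l\<in>J. \<forall>x\<in>P. a k \<bullet> x = b k \<longrightarrow> a l \<bullet> x = b l"
  shows "card (maximal_proper_faces P) = card J"
proof -
  define \<Phi> where "\<Phi> k = P \<inter> {x. a k \<bullet> x = b k}" for k
  have "P = {x. c \<bullet> x = d} \<inter> (\<Inter>k\<in>I. {x. a k \<bullet> x \<le> b k})"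
    unfolding P by auto
  also have "convex \<dots>"
    by (intro convex_Int convex_INT convex_hyperplane convex_halfspace_le)
  finally have cP: "convex P" .
  have face: "\<Phi> k face_of P" if "k \<in> I" for k
    unfolding \<Phi>_def using cP that P by (intro face_of_Int_supporting_hyperplane_le) auto
  have proper: "\<Phi> k \<noteq> P" if "k \<in> J" for k using strict[OF that] unfolding \<Phi>_def by force
  have incomparable: "k = l" if kl: "k \<in> J" "l \<in> J" "\<Phi> k \<subseteq> \<Phi> l" for k l
  proof (rule ccontr)
    assume "k \<noteq> l"
    then obtain x where x: "x \<in> P" "a k \<bullet> x = b k" "a l \<bullet> x < b l" using tight[OF kl(1)] kl(2) by blast
    then have "x \<in> \<Phi> k" "x \<notin> \<Phi> l" by (auto simp: \<Phi>_def)
    then show False using kl(3) by blast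
  qed
  have covered: "\<exists>l\<in>J. F \<subseteq> \<Phi> l" if F: "F face_of P" "F \<noteq> P" for F
  proof (cases "F = {}")
    case True then show ?thesis using I by auto
  next
    case False
    then obtain k where k: "k \<in> I" "F \<subseteq> \<Phi> k"
      using proper_face_subset_tight[OF I(1) _ P F] I unfolding \<Phi>_def by blast
    show ?thesis
    proof (cases "k \<in> J")
      case True then show ?thesis using k by blast
    next
      case False
      then obtain l where "l \<in> J" "\<forall>x\<in>P. a k \<bullet> x = b k \<longrightarrow> a l \<bullet> x = b l"
        using redundant[of k] k by blast
      then have "\<Phi> k \<subseteq> \<Phi> l" by (auto simp: \<Phi>_def)
      then show ?thesis using k \<open>l \<in> J\<close> by blast
    qed
  qed
  have mpf: "F \<in> maximal_proper_faces P \<longleftrightarrow>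
      F face_of P \<and> F \<noteq> P \<and> (\<forall>G. G face_of P \<and> F \<subseteq> G \<longrightarrow> G = F \<or> G = P)" for F
    by (simp add: maximal_proper_faces_def)
  have "maximal_proper_faces P = \<Phi> ` J"
  proof
    show "maximal_proper_faces P \<subseteq> \<Phi> ` J"
    proof
      fix F assume F: "F \<in> maximal_proper_faces P"
      then have "F face_of P" "F \<noteq> P" by (simp_all add: mpf)
      then obtain l where l: "l \<in> J" "F \<subseteq> \<Phi> l" using covered by blast
      moreover have "\<Phi> l face_of P" "\<Phi> l \<noteq> P" using l I face proper by auto
      ultimately have "\<Phi> l = F" using F unfolding mpf by blast
      then show "F \<in> \<Phi> ` J" using l by blast
    qed
    show "\<Phi> ` J \<subseteq> maximal_proper_faces P"
    proof
      fix F assume "F \<in> \<Phi> ` J"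
      then obtain k where k: "k \<in> J" "F = \<Phi> k" by blast
      have max: "G = F \<or> G = P" if G: "G face_of P \<and> F \<subseteq> G" for G
      proof (cases "G = P")
        case False
        then obtain l where l: "l \<in> J" "G \<subseteq> \<Phi> l" using covered G by blast
        then have "\<Phi> k \<subseteq> \<Phi> l" using k G by blast
        then have "k = l" using incomparable k l by blast
        then show ?thesis using k l G by blast
      qed simp
      have "F face_of P" "F \<noteq> P" using k I face proper by auto
      then show "F \<in> maximal_proper_faces P" unfolding mpf using max by blast
    qed
  qed
  moreover have "inj_on \<Phi> J" using incomparable by (intro inj_onI) blast
  ultimately show ?thesis by (simp add: card_image)
qed

section \<open>The facets of a slab of the hypersimplex\<close>

text \<open>The slab between the hyperplanes \<open>x(A) = 1\<close> and \<open>x(A') = 1\<close>. For \<open>A = {}\<close> or \<open>A' = UNIV\<close> the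
  corresponding bound is vacuous, which covers the first and the last slab of a decomposition.\<close>

definition slab_constraints :: "nat \<Rightarrow> 'a set \<Rightarrow> 'a set \<Rightarrow> ('a set \<times> nat \<times> nat) set" where
  "slab_constraints r A A' = {(UNIV, r, r), (A, 0, 1), (A', 1, r)}"

definition slab_bases :: "nat \<Rightarrow> 'a set \<Rightarrow> 'a set \<Rightarrow> 'a set set" where
  "slab_bases r A A' = chain_bases (slab_constraints r A A')"

text \<open>These conditions make the slab full-dimensional and different from the whole hypersimplex, and each
  of its bounding hyperplanes, as far as present, defines a facet.\<close>

definition proper_slab :: "nat \<Rightarrow> 'n::finite set \<Rightarrow> 'n set \<Rightarrow> bool" where
  "proper_slab r A A' \<longleftrightarrow> 2 \<le> r \<and> A \<subset> A' \<and> (A = {} \<longrightarrow> A' \<noteq> UNIV \<and> 2 \<le> card A') \<and>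
     (A \<noteq> {} \<longrightarrow> 2 \<le> card A) \<and> (A' \<noteq> UNIV \<longrightarrow> r \<le> card (- A')) \<and>
     (A' = UNIV \<longrightarrow> r \<le> card (- A))"

lemma base_polytope_slab_bases:
  assumes "A \<subseteq> A'"
  shows "base_polytope (slab_bases r A A') = {x. (\<forall>i. 0 \<le> x $ i \<and> x $ i \<le> 1) \<and>
     (\<Sum>i\<in>UNIV. x $ i) = real r \<and> (\<Sum>i\<in>A. x $ i) \<le> 1 \<and> 1 \<le> (\<Sum>i\<in>A'. x $ i)}"
proof -
  have "chain_constraints (slab_constraints r A A') r"
    using assms by (auto simp: chain_constraints_def slab_constraints_def)
  then have "base_polytope (slab_bases r A A') = chain_polytope (slab_constraints r A A')"
    unfolding slab_bases_def by (rule base_polytope_chain_bases)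
  moreover have "0 \<le> (\<Sum>i\<in>A. x $ i)" "(\<Sum>i\<in>A'. x $ i) \<le> (\<Sum>i\<in>UNIV. x $ i)"
    if "\<forall>i. 0 \<le> x $ i" for x :: "real^'a"
    using that by (auto intro: sum_nonneg sum_mono2)
  ultimately show ?thesis
    unfolding chain_polytope_def slab_constraints_def by force
qed

text \<open>Names for the inequalities \<open>0 \<le> x_i\<close>, \<open>x_i \<le> 1\<close>, \<open>x(A) \<le> 1\<close> and \<open>1 \<le> x(A')\<close>.\<close>

datatype 'n slab_ineq = Lower 'n | Upper 'n | Inner | Outer

instance slab_ineq :: (finite) finite
proof
  have "k \<in> range Lower \<union> range Upper \<union> {Inner, Outer}" for k :: "'a slab_ineq"
    by (cases k) auto
  then have "UNIV \<subseteq> range Lower \<union> range Upper \<union> {Inner, Outer :: 'a slab_ineq}" by blast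
  then show "finite (UNIV :: 'a slab_ineq set)" by (rule finite_subset) simp
qed

fun slab_normal :: "'n::finite set \<Rightarrow> 'n set \<Rightarrow> 'n slab_ineq \<Rightarrow> real^'n" where
  "slab_normal A A' (Lower i) = - axis i 1"
| "slab_normal A A' (Upper i) = axis i 1"
| "slab_normal A A' Inner = (\<Sum>i\<in>A. axis i 1)"
| "slab_normal A A' Outer = - (\<Sum>i\<in>A'. axis i 1)"

fun slab_offset :: "'n slab_ineq \<Rightarrow> real" where
  "slab_offset (Lower i) = 0"
| "slab_offset (Upper i) = 1"
| "slab_offset Inner = 1"
| "slab_offset Outer = - 1"

lemma inner_slab_normal [simp]:
  "slab_normal A A' (Lower i) \<bullet> x = - x $ i"
  "slab_normal A A' (Upper i) \<bullet> x = x $ i"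
  "slab_normal A A' Inner \<bullet> x = (\<Sum>i\<in>A. x $ i)"
  "slab_normal A A' Outer \<bullet> x = - (\<Sum>i\<in>A'. x $ i)"
  by (simp_all add: inner_axis inner_axis' inner_sum_left)

declare slab_normal.simps [simp del]

lemma all_slab_ineq_iff:
  "(\<forall>k. Q k) \<longleftrightarrow> (\<forall>i. Q (Lower i)) \<and> (\<forall>i. Q (Upper i)) \<and> Q Inner \<and> Q Outer"
  by (metis slab_ineq.exhaust)

lemma base_polytope_slab_ineqs:
  assumes "A \<subseteq> A'"
  shows "base_polytope (slab_bases r A A') = {x. (\<Sum>i\<in>UNIV. axis i 1) \<bullet> x = real r \<and>
     (\<forall>k\<in>UNIV. slab_normal A A' k \<bullet> x \<le> slab_offset k)}"
  unfolding base_polytope_slab_bases[OF assms]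
  by (auto simp: all_slab_ineq_iff inner_axis' inner_sum_left)

text \<open>The sums over \<open>X\<close> that can be achieved with all coordinates strictly between 0 and 1.\<close>

definition fits :: "'a set \<Rightarrow> real \<Rightarrow> bool" where
  "fits X \<sigma> \<longleftrightarrow> (X = {} \<and> \<sigma> = 0) \<or> (0 < \<sigma> \<and> \<sigma> < card X)"

text \<open>Points of a slab are prescribed by giving the coordinates in a small set \<open>S\<close> a common value \<open>v\<close> and
  choosing the sums over the rest of the three blocks \<open>A\<close>, \<open>A' - A\<close> and \<open>- A'\<close>; each sum is spread evenly
  over its block.\<close>

lemma block_point:
  fixes A A' S :: "'n::finite set"
  assumes sub: "A \<subseteq> A'" and fit: "fits (A - S) \<alpha>" "fits (A' - A - S) \<beta>" "fits (- A' - S) \<gamma>"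
  obtains x :: "real^'n"
  where "\<And>i. i \<in> S \<Longrightarrow> x $ i = v" "\<And>i. i \<notin> S \<Longrightarrow> 0 < x $ i \<and> x $ i < 1"
    "(\<Sum>i\<in>A. x $ i) = v * card (A \<inter> S) + \<alpha>"
    "(\<Sum>i\<in>A'. x $ i) = v * card (A' \<inter> S) + \<alpha> + \<beta>"
    "(\<Sum>i\<in>UNIV. x $ i) = v * card S + \<alpha> + \<beta> + \<gamma>"
proof -
  define x :: "real^'n" where "x = (\<chi> i. if i \<in> S then v else if i \<in> A then \<alpha> / card (A - S)
     else if i \<in> A' then \<beta> / card (A' - A - S) else \<gamma> / card (- A' - S))"
  have S: "x $ i = v" if "i \<in> S" for i using that by (simp add: x_def)
  have unit: "0 < \<sigma> / card X \<and> \<sigma> / card X < 1" if "fits X \<sigma>" "i \<in> X" for X :: "'n set" and \<sigma> i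
    using that unfolding fits_def by auto
  have frac: "0 < x $ i \<and> x $ i < 1" if "i \<notin> S" for i
    using that unit[OF fit(1), of i] unit[OF fit(2), of i] unit[OF fit(3), of i] by (simp add: x_def)
  have block: "(\<Sum>i\<in>X. x $ i) = \<sigma>" if "fits X \<sigma>" "\<And>i. i \<in> X \<Longrightarrow> x $ i = \<sigma> / card X" for X \<sigma>
    using that unfolding fits_def by auto
  have b: "(\<Sum>i\<in>A - S. x $ i) = \<alpha>" "(\<Sum>i\<in>A' - A - S. x $ i) = \<beta>"
    "(\<Sum>i\<in>- A' - S. x $ i) = \<gamma>"
  proof -
    show "(\<Sum>i\<in>A - S. x $ i) = \<alpha>" by (rule block[OF fit(1)]) (simp add: x_def)
    show "(\<Sum>i\<in>A' - A - S. x $ i) = \<beta>" by (rule block[OF fit(2)]) (simp add: x_def)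
    show "(\<Sum>i\<in>- A' - S. x $ i) = \<gamma>" using sub by (intro block[OF fit(3)]) (auto simp: x_def)
  qed
  have split: "(\<Sum>i\<in>X. x $ i) = v * card (X \<inter> S) + (\<Sum>i\<in>X - S. x $ i)" for X
    using S by (subst sum.Int_Diff[of X _ S]) auto
  have A: "(\<Sum>i\<in>A. x $ i) = v * card (A \<inter> S) + \<alpha>" using split[of A] b by simp
  have "A' - S = (A - S) \<union> (A' - A - S)" using sub by auto
  then have "(\<Sum>i\<in>A' - S. x $ i) = (\<Sum>i\<in>A - S. x $ i) + (\<Sum>i\<in>A' - A - S. x $ i)"
    by (simp only:) (rule sum.union_disjoint; auto)
  then have "(\<Sum>i\<in>A' - S. x $ i) = \<alpha> + \<beta>" using b by simp
  then have A': "(\<Sum>i\<in>A'. x $ i) = v * card (A' \<inter> S) + \<alpha> + \<beta>" using split[of A'] by simp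
  have "(\<Sum>i\<in>UNIV. x $ i) = (\<Sum>i\<in>A'. x $ i) + (\<Sum>i\<in>- A'. x $ i)"
    by (subst sum.union_disjoint[symmetric]) auto
  also have "\<dots> = v * card (A' \<inter> S) + v * card (- A' \<inter> S) + \<alpha> + \<beta> + \<gamma>"
    using split[of "- A'"] A' b by simp
  also have "real (card (A' \<inter> S)) + card (- A' \<inter> S) = card S"
    by (subst of_nat_add[symmetric], subst card_Un_disjoint[symmetric]) (auto intro: arg_cong[where f = card])
  then have "v * card (A' \<inter> S) + v * card (- A' \<inter> S) = v * card S" by (metis distrib_left)
  finally have U: "(\<Sum>i\<in>UNIV. x $ i) = v * card S + \<alpha> + \<beta> + \<gamma>" by simp
  show thesis using that[of x] S frac A A' U by blast
qed

text \<open>The condition for \<open>0 \<le> x_i\<close> to define a facet when \<open>i \<in> A' - A\<close>: one coordinate of the middle block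
  can vanish while all other inequalities stay strict. Without an inner block the sum over the middle
  block must exceed 1, and without an outer block it must exceed \<open>r - 1\<close>.\<close>

definition roomy_slab :: "nat \<Rightarrow> 'n::finite set \<Rightarrow> 'n set \<Rightarrow> bool" where
  "roomy_slab r A A' \<longleftrightarrow>
     (if A = {} then 3 else if A' = UNIV then r + 1 else 2) \<le> card (A' - A)"

text \<open>For \<open>i \<in> A\<close> the inequality \<open>x_i \<le> 1\<close> follows from \<open>x(A) \<le> 1\<close>. For \<open>i \<notin> A'\<close> and \<open>r = 2\<close> it follows from
  \<open>1 \<le> x(A')\<close>.\<close>

definition slab_facets :: "nat \<Rightarrow> 'n::finite set \<Rightarrow> 'n set \<Rightarrow> 'n slab_ineq set" where
  "slab_facets r A A' = Lower ` {i. i \<in> A' - A \<longrightarrow> roomy_slab r A A'} \<union>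
     Upper ` {i. i \<notin> A \<and> (i \<in> A' \<or> 3 \<le> r)} \<union>
     {k. k = Inner \<and> A \<noteq> {} \<or> k = Outer \<and> A' \<noteq> UNIV}"

lemma slab_blocks:
  assumes "proper_slab r A A'"
  shows "2 \<le> r" "A \<subset> A'" "A = {} \<Longrightarrow> A' \<noteq> UNIV" "A = {} \<Longrightarrow> 2 \<le> card (A' - A)"
    "A \<noteq> {} \<Longrightarrow> 2 \<le> card A" "A' \<noteq> UNIV \<Longrightarrow> r \<le> card (- A')"
    "A' = UNIV \<Longrightarrow> r \<le> card (A' - A)" "1 \<le> card (A' - A)"
proof -
  have "A' - A \<noteq> {}" using assms by (auto simp: proper_slab_def)
  then show "1 \<le> card (A' - A)" by (simp add: Suc_le_eq card_gt_0_iff)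
qed (use assms in \<open>auto simp: proper_slab_def Compl_eq_Diff_UNIV\<close>)

text \<open>For \<open>S = {}\<close> this is an interior point. In this lemma and the three after it, the sums over the
  blocks are numerical choices that keep \<open>x(A)\<close> below 1 and \<open>x(A')\<close> above 1, unless equality is asked
  for. An empty block must receive the sum 0, which accounts for the case distinctions.\<close>

lemma slab_point_lower:
  fixes A A' :: "'n::finite set"
  assumes P: "proper_slab r A A'" and S: "S = {} \<or> (\<exists>i. S = {i} \<and> (i \<in> A' - A \<longrightarrow> roomy_slab r A A'))"
  obtains x :: "real^'n" where "\<And>i. i \<in> S \<Longrightarrow> x $ i = 0" "\<And>i. i \<notin> S \<Longrightarrow> 0 < x $ i \<and> x $ i < 1"
    "(\<Sum>i\<in>A. x $ i) < 1" "(\<Sum>i\<in>A'. x $ i) > 1" "(\<Sum>i\<in>UNIV. x $ i) = real r"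
proof -
  note b = slab_blocks[OF P]
  define \<alpha> :: real where "\<alpha> = (if A = {} then 0 else 3/4)"
  define \<gamma> :: real where "\<gamma> = (if A' = UNIV then 0 else r - 5/4)"
  define \<beta> :: real where "\<beta> = r - \<alpha> - \<gamma>"
  have cS: "card X \<le> card (X - S) + 1" for X :: "'n set"
  proof -
    consider "S = {}" | i where "S = {i}" using S by blast
    then show ?thesis by cases (auto simp: card_Diff_singleton_if simp flip: Suc_le_eq)
  qed
  have "card (A' - A - S) = card (A' - A)" if "\<not> roomy_slab r A A'"
    using S that by (auto simp: card_Diff_singleton_if)
  then have E: "(if A = {} then 2 else if A' = UNIV then r else 1) \<le> card (A' - A - S)"
    using b(3,4,7,8) cS[of "A' - A"] unfolding roomy_slab_def
    by (cases "A = {}"; cases "A' = UNIV"; cases "roomy_slab r A A'") (simp_all add: roomy_slab_def)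
  have f: "fits (A - S) \<alpha>" "fits (A' - A - S) \<beta>" "fits (- A' - S) \<gamma>"
  proof -
    show "fits (A - S) \<alpha>"
      using b(5) cS[of A] by (cases "A = {}") (simp_all add: fits_def \<alpha>_def)
    show "fits (- A' - S) \<gamma>"
      using b(1,6) cS[of "- A'"] by (cases "A' = UNIV") (simp_all add: fits_def \<gamma>_def)
    show "fits (A' - A - S) \<beta>"
      using E b(1,3) by (cases "A = {}"; cases "A' = UNIV") (simp_all add: fits_def \<alpha>_def \<beta>_def \<gamma>_def)
  qed
  show thesis
  proof (rule block_point[OF _ f, where v = 0])
    show "A \<subseteq> A'" using b by simp
    fix x :: "real^'n"
    assume "\<And>i. i \<in> S \<Longrightarrow> x $ i = 0" "\<And>i. i \<notin> S \<Longrightarrow> 0 < x $ i \<and> x $ i < 1"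
      "(\<Sum>i\<in>A. x $ i) = 0 * real (card (A \<inter> S)) + \<alpha>"
      "(\<Sum>i\<in>A'. x $ i) = 0 * real (card (A' \<inter> S)) + \<alpha> + \<beta>"
      "(\<Sum>i\<in>UNIV. x $ i) = 0 * real (card S) + \<alpha> + \<beta> + \<gamma>"
    moreover have "\<alpha> < 1" "\<alpha> + \<beta> > 1" "\<alpha> + \<beta> + \<gamma> = r"
      using b(1,3) by (auto simp: \<alpha>_def \<beta>_def \<gamma>_def)
    ultimately show thesis by (intro that[of x]) auto
  qed
qed

lemma slab_point_upper:
  fixes A A' :: "'n::finite set"
  assumes P: "proper_slab r A A'" and i: "i \<notin> A" "i \<in> A' \<or> 3 \<le> r"
  obtains x :: "real^'n" where "x $ i = 1" "\<And>j. j \<noteq> i \<Longrightarrow> 0 < x $ j \<and> x $ j < 1"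
    "(\<Sum>i\<in>A. x $ i) < 1" "(\<Sum>i\<in>A'. x $ i) > 1" "(\<Sum>i\<in>UNIV. x $ i) = real r"
proof (cases "i \<in> A'")
  case True
  note b = slab_blocks[OF P]
  define \<alpha> :: real where "\<alpha> = (if A = {} then 0 else 1/4)"
  define \<gamma> :: real where "\<gamma> = (if A' = UNIV then 0 else if A' - A = {i} then real r - 1 - \<alpha> else r - 3/2)"
  define \<beta> :: real where "\<beta> = real r - 1 - \<alpha> - \<gamma>"
  have E: "card (A' - A) = card (A' - A - {i}) + 1"
    using True i b(8) by (simp add: card_Diff_singleton_if)
  have "A - {i} = A" "- A' - {i} = - A'" using True i by auto
  then have f: "fits (A - {i}) \<alpha>" "fits (A' - A - {i}) \<beta>" "fits (- A' - {i}) \<gamma>"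
  proof -
    assume e: "A - {i} = A" "- A' - {i} = - A'"
    show "fits (A - {i}) \<alpha>"
      unfolding e using b(5) by (cases "A = {}") (simp_all add: fits_def \<alpha>_def)
    show "fits (- A' - {i}) \<gamma>"
      unfolding e using b(1,4,6) by (cases "A' = UNIV"; cases "A = {}") (auto simp: fits_def \<gamma>_def \<alpha>_def)
    show "fits (A' - A - {i}) \<beta>"
    proof (cases "A' - A = {i}")
      case True
      then have "A \<noteq> {}" "A' \<noteq> UNIV" using b(1,4,7) by force+
      then show ?thesis using True by (simp add: fits_def \<beta>_def \<gamma>_def)
    next
      case False
      then have "A' - A - {i} \<noteq> {}" using True i by blast
      then have "1 \<le> card (A' - A - {i})" by (simp add: Suc_le_eq card_gt_0_iff)
      then show ?thesis using False b(1,3,7) E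
        by (cases "A = {}"; cases "A' = UNIV") (simp_all add: fits_def \<alpha>_def \<beta>_def \<gamma>_def)
    qed
  qed
  show thesis
  proof (rule block_point[OF _ f, where v = 1])
    show "A \<subseteq> A'" using b by simp
    fix x :: "real^'n"
    assume "\<And>j. j \<in> {i} \<Longrightarrow> x $ j = 1" "\<And>j. j \<notin> {i} \<Longrightarrow> 0 < x $ j \<and> x $ j < 1"
      "(\<Sum>i\<in>A. x $ i) = 1 * real (card (A \<inter> {i})) + \<alpha>"
      "(\<Sum>i\<in>A'. x $ i) = 1 * real (card (A' \<inter> {i})) + \<alpha> + \<beta>"
      "(\<Sum>i\<in>UNIV. x $ i) = 1 * real (card {i}) + \<alpha> + \<beta> + \<gamma>"
    moreover have "\<alpha> < 1" "1 + \<alpha> + \<beta> + \<gamma> = r"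
      by (simp_all add: \<alpha>_def \<beta>_def)
    moreover have "\<alpha> + \<beta> > 0"
    proof (cases "A' - A = {i}")
      case True
      then have "A \<noteq> {}" using b(4) by force
      then show ?thesis using b(1) by (simp add: \<alpha>_def \<beta>_def \<gamma>_def)
    next
      case False
      then show ?thesis using b(1) by (simp add: \<beta>_def \<gamma>_def)
    qed
    ultimately show thesis using True i by (intro that[of x]) auto
  qed
next
  case False
  note b = slab_blocks[OF P]
  have ne: "A' \<noteq> UNIV" and r: "3 \<le> r" using False i by auto
  define \<alpha> :: real where "\<alpha> = (if A = {} then 0 else 3/4)"
  define \<beta> :: real where "\<beta> = 5/4 - \<alpha>"
  have "A - {i} = A" "A' - A - {i} = A' - A" using False i by auto
  moreover have "card (- A') = card (- A' - {i}) + 1"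
    using False card_Suc_Diff1[of "- A'" i] by simp
  ultimately have f: "fits (A - {i}) \<alpha>" "fits (A' - A - {i}) \<beta>" "fits (- A' - {i}) (r - 9/4)"
    using b(4,5,6,8) ne r by (cases "A = {}"; simp add: fits_def \<alpha>_def \<beta>_def)+
  show thesis
  proof (rule block_point[OF _ f, where v = 1])
    show "A \<subseteq> A'" using b by simp
    fix x :: "real^'n"
    assume "\<And>j. j \<in> {i} \<Longrightarrow> x $ j = 1" "\<And>j. j \<notin> {i} \<Longrightarrow> 0 < x $ j \<and> x $ j < 1"
      "(\<Sum>i\<in>A. x $ i) = 1 * real (card (A \<inter> {i})) + \<alpha>"
      "(\<Sum>i\<in>A'. x $ i) = 1 * real (card (A' \<inter> {i})) + \<alpha> + \<beta>"
      "(\<Sum>i\<in>UNIV. x $ i) = 1 * real (card {i}) + \<alpha> + \<beta> + (r - 9/4)"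
    then show thesis using False i by (intro that[of x]) (auto simp: \<alpha>_def \<beta>_def)
  qed
qed

lemma slab_point_inner:
  fixes A A' :: "'n::finite set"
  assumes P: "proper_slab r A A'" and "A \<noteq> {}"
  obtains x :: "real^'n" where "\<And>j. 0 < x $ j \<and> x $ j < 1"
    "(\<Sum>i\<in>A. x $ i) = 1" "(\<Sum>i\<in>A'. x $ i) > 1" "(\<Sum>i\<in>UNIV. x $ i) = real r"
proof -
  note b = slab_blocks[OF P]
  define \<gamma> :: real where "\<gamma> = (if A' = UNIV then 0 else r - 5/4)"
  have f: "fits (A - {}) 1" "fits (A' - A - {}) (real r - 1 - \<gamma>)" "fits (- A' - {}) \<gamma>"
    using b(1,5,6,7,8) assms(2) by (cases "A' = UNIV"; simp add: fits_def \<gamma>_def)+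
  show thesis
  proof (rule block_point[OF _ f])
    show "A \<subseteq> A'" using b by simp
    fix x :: "real^'n"
    assume "\<And>j. j \<notin> {} \<Longrightarrow> 0 < x $ j \<and> x $ j < 1"
      "(\<Sum>i\<in>A. x $ i) = 0 * real (card (A \<inter> {})) + 1"
      "(\<Sum>i\<in>A'. x $ i) = 0 * real (card (A' \<inter> {})) + 1 + (real r - 1 - \<gamma>)"
      "(\<Sum>i\<in>UNIV. x $ i) = 0 * real (card ({}::'n set)) + 1 + (real r - 1 - \<gamma>) + \<gamma>"
    moreover have "real r - 1 - \<gamma> > 0" using b(1) by (auto simp: \<gamma>_def)
    ultimately show thesis by (intro that[of x]) auto
  qed
qed

lemma slab_point_outer:
  fixes A A' :: "'n::finite set"
  assumes P: "proper_slab r A A'" and "A' \<noteq> UNIV"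
  obtains x :: "real^'n" where "\<And>j. 0 < x $ j \<and> x $ j < 1"
    "(\<Sum>i\<in>A. x $ i) < 1" "(\<Sum>i\<in>A'. x $ i) = 1" "(\<Sum>i\<in>UNIV. x $ i) = real r"
proof -
  note b = slab_blocks[OF P]
  define \<alpha> :: real where "\<alpha> = (if A = {} then 0 else 3/4)"
  have f: "fits (A - {}) \<alpha>" "fits (A' - A - {}) (1 - \<alpha>)" "fits (- A' - {}) (real r - 1)"
    using b(1,4,5,6,8) assms(2) by (cases "A = {}"; simp add: fits_def \<alpha>_def)+
  show thesis
  proof (rule block_point[OF _ f])
    show "A \<subseteq> A'" using b by simp
    fix x :: "real^'n"
    assume "\<And>j. j \<notin> {} \<Longrightarrow> 0 < x $ j \<and> x $ j < 1"
      "(\<Sum>i\<in>A. x $ i) = 0 * real (card (A \<inter> {})) + \<alpha>"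
      "(\<Sum>i\<in>A'. x $ i) = 0 * real (card (A' \<inter> {})) + \<alpha> + (1 - \<alpha>)"
      "(\<Sum>i\<in>UNIV. x $ i) = 0 * real (card ({}::'n set)) + \<alpha> + (1 - \<alpha>) + (real r - 1)"
    then show thesis by (intro that[of x]) (auto simp: \<alpha>_def)
  qed
qed

lemma slab_subset:
  assumes "proper_slab r A A'" shows "A \<subseteq> A'"
  using assms by (auto simp: proper_slab_def)

lemma slab_interior_point:
  assumes P: "proper_slab r A A'"
  obtains x :: "real^'n::finite" where "(\<Sum>i\<in>UNIV. x $ i) = real r" "\<And>i. 0 < x $ i \<and> x $ i < 1"
    "(\<Sum>i\<in>A. x $ i) < 1" "1 < (\<Sum>i\<in>A'. x $ i)"
  by (rule slab_point_lower[OF P, of "{}"]) (use that in auto)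

lemma slab_tight_point:
  fixes A A' :: "'n::finite set"
  assumes P: "proper_slab r A A'" and k: "k \<in> slab_facets r A A'"
  shows "\<exists>x. (\<Sum>i\<in>UNIV. x $ i) = real r \<and> slab_normal A A' k \<bullet> x = slab_offset k \<and>
    (\<forall>l. l \<noteq> k \<longrightarrow> slab_normal A A' l \<bullet> x < slab_offset l)"
proof (cases k)
  case (Lower i)
  then have "i \<in> A' - A \<longrightarrow> roomy_slab r A A'" using k by (auto simp: slab_facets_def)
  then have "{i} = {} \<or> (\<exists>j. {i} = {j} \<and> (j \<in> A' - A \<longrightarrow> roomy_slab r A A'))" by blast
  from slab_point_lower[OF P this] obtain x :: "real^'n" where x: "x $ i = 0"
    "\<And>j. j \<noteq> i \<Longrightarrow> 0 < x $ j \<and> x $ j < 1" "(\<Sum>i\<in>A. x $ i) < 1" "(\<Sum>i\<in>A'. x $ i) > 1"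
    "(\<Sum>i\<in>UNIV. x $ i) = real r" by auto
  then have "x $ j < 1" for j by (cases "j = i") auto
  then show ?thesis using x Lower by (intro exI[of _ x]) (simp add: all_slab_ineq_iff)
next
  case (Upper i)
  then have "i \<notin> A" "i \<in> A' \<or> 3 \<le> r" using k by (auto simp: slab_facets_def)
  from slab_point_upper[OF P this] obtain x :: "real^'n" where x: "x $ i = 1"
    "\<And>j. j \<noteq> i \<Longrightarrow> 0 < x $ j \<and> x $ j < 1" "(\<Sum>i\<in>A. x $ i) < 1" "(\<Sum>i\<in>A'. x $ i) > 1"
    "(\<Sum>i\<in>UNIV. x $ i) = real r" by blast
  then have "0 < x $ j" for j by (cases "j = i") auto
  then show ?thesis using x Upper by (intro exI[of _ x]) (simp add: all_slab_ineq_iff)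
next
  case Inner
  then have "A \<noteq> {}" using k by (auto simp: slab_facets_def)
  from slab_point_inner[OF P this] obtain x :: "real^'n" where "\<And>j. 0 < x $ j \<and> x $ j < 1"
    "(\<Sum>i\<in>A. x $ i) = 1" "(\<Sum>i\<in>A'. x $ i) > 1" "(\<Sum>i\<in>UNIV. x $ i) = real r" by blast
  then show ?thesis using Inner by (intro exI[of _ x]) (simp add: all_slab_ineq_iff)
next
  case Outer
  then have "A' \<noteq> UNIV" using k by (auto simp: slab_facets_def)
  from slab_point_outer[OF P this] obtain x :: "real^'n" where "\<And>j. 0 < x $ j \<and> x $ j < 1"
    "(\<Sum>i\<in>A. x $ i) < 1" "(\<Sum>i\<in>A'. x $ i) = 1" "(\<Sum>i\<in>UNIV. x $ i) = real r" by blast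
  then show ?thesis using Outer by (intro exI[of _ x]) (simp add: all_slab_ineq_iff)
qed

text \<open>For each inequality outside of \<open>slab_facets\<close>, either its tightness forces another inequality to be tight,
  or it is strict on the whole slab. The second case occurs for the missing hyperplane of the
  first or last slab.\<close>

lemma slab_redundant:
  fixes A A' :: "'n::finite set"
  assumes P: "proper_slab r A A'" and k: "k \<notin> slab_facets r A A'"
  shows "\<exists>l\<in>slab_facets r A A'. \<forall>x\<in>base_polytope (slab_bases r A A').
    slab_normal A A' k \<bullet> x = slab_offset k \<longrightarrow> slab_normal A A' l \<bullet> x = slab_offset l"
proof -
  note b = slab_blocks[OF P]
  obtain e where e: "e \<in> A'" "e \<notin> A" using b(2) by blast
  then have eJ: "Upper e \<in> slab_facets r A A'" by (auto simp: slab_facets_def)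
  have poly: "\<And>i. 0 \<le> x $ i" "\<And>i. x $ i \<le> 1" "(\<Sum>i\<in>UNIV. x $ i) = real r" "(\<Sum>i\<in>A. x $ i) \<le> 1"
    "1 \<le> (\<Sum>i\<in>A'. x $ i)" "(\<Sum>i\<in>A'. x $ i) = (\<Sum>i\<in>A. x $ i) + (\<Sum>i\<in>A' - A. x $ i)"
    if "x \<in> base_polytope (slab_bases r A A')" for x
    using that sum.subset_diff[of A A' "($) x"] slab_subset[OF P]
    unfolding base_polytope_slab_bases[OF slab_subset[OF P]] by (auto simp: add.commute)
  show ?thesis
  proof (cases k)
    case (Lower i)
    then have i: "i \<in> A' - A" and tight: "\<not> roomy_slab r A A'" using k by (auto simp: slab_facets_def)
    have split: "(\<Sum>j\<in>A' - A. x $ j) = x $ i + (\<Sum>j\<in>A' - A - {i}. x $ j)" for x :: "real^'n"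
      using i by (intro sum.remove) auto
    show ?thesis
    proof (cases "A = {}")
      case True
      then have "card (A' - A) = 2" using b(4) tight by (simp add: roomy_slab_def)
      then have "card (A' - A - {i}) = 1" using i by simp
      then obtain j where j: "A' - A - {i} = {j}" by (rule card_1_singletonE)
      then have "j \<in> A'" "j \<notin> A" by auto
      then have "Upper j \<in> slab_facets r A A'" by (auto simp: slab_facets_def)
      moreover have "x $ j = 1" if x: "x \<in> base_polytope (slab_bases r A A')" and "x $ i = 0" for x
      proof -
        have "(\<Sum>j\<in>A' - A. x $ j) = x $ j" using split[of x] that(2) unfolding j by simp
        moreover have "(\<Sum>i\<in>A. x $ i) = 0" using True by simp
        ultimately show ?thesis using poly(2)[OF x, of j] poly(5,6)[OF x] by linarith
      qed
      ultimately show ?thesis using Lower by (intro bexI[of _ "Upper j"]) auto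
    next
      case False
      have "1 \<le> (\<Sum>i\<in>A. x $ i)" if x: "x \<in> base_polytope (slab_bases r A A')" and "x $ i = 0" for x
      proof (cases "A' = UNIV")
        case True
        then have "card (A' - A - {i}) = r - 1"
          using b(7) tight False i by (simp add: roomy_slab_def)
        moreover have "(\<Sum>j\<in>A' - A - {i}. x $ j) \<le> (\<Sum>j\<in>A' - A - {i}. 1)"
          using poly(2)[OF x] by (intro sum_mono) auto
        ultimately have "(\<Sum>j\<in>A' - A - {i}. x $ j) \<le> real r - 1" using b(1) by simp
        then show ?thesis using poly(3,6)[OF x] split[of x] that(2) unfolding True by linarith
      next
        case nU: False
        then have "card (A' - A) = 1" using tight False b(8) by (simp add: roomy_slab_def)
        then obtain z where "A' - A = {z}" by (rule card_1_singletonE)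
        then have "A' - A - {i} = {}" using i by auto
        then have "(\<Sum>j\<in>A' - A. x $ j) = 0" using split[of x] that(2) by (metis add_0 sum.empty)
        then show ?thesis using poly(5,6)[OF x] by linarith
      qed
      then have "(\<Sum>i\<in>A. x $ i) = 1" if "x \<in> base_polytope (slab_bases r A A')" "x $ i = 0" for x
        using poly(4)[OF that(1)] that by (simp add: order_antisym)
      moreover have "Inner \<in> slab_facets r A A'" using False by (simp add: slab_facets_def)
      ultimately show ?thesis using Lower by (intro bexI[of _ Inner]) auto
    qed
  next
    case (Upper i)
    show ?thesis
    proof (cases "i \<in> A")
      case True
      have "x $ i \<le> (\<Sum>j\<in>A. x $ j)" if x: "x \<in> base_polytope (slab_bases r A A')" for x
        using True poly(1)[OF x] by (intro member_le_sum) auto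
      then have "(\<Sum>j\<in>A. x $ j) = 1" if "x \<in> base_polytope (slab_bases r A A')" "x $ i = 1" for x
        using poly(4)[OF that(1)] that by (metis order_antisym)
      moreover have "Inner \<in> slab_facets r A A'" using True by (auto simp: slab_facets_def)
      ultimately show ?thesis using Upper by (intro bexI[of _ Inner]) auto
    next
      case False
      then have i: "i \<notin> A'" and r: "r = 2" using Upper k b(1) by (auto simp: slab_facets_def)
      have "(\<Sum>j\<in>A'. x $ j) = 1" if x: "x \<in> base_polytope (slab_bases r A A')" and "x $ i = 1" for x
      proof -
        have "(\<Sum>j\<in>insert i A'. x $ j) \<le> (\<Sum>j\<in>UNIV. x $ j)"
          using poly(1)[OF x] by (intro sum_mono2) auto
        then show ?thesis using i r that(2) poly(3,5)[OF x] by simp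
      qed
      moreover have "Outer \<in> slab_facets r A A'" using i by (auto simp: slab_facets_def)
      ultimately show ?thesis using Upper by (intro bexI[of _ Outer]) auto
    qed
  next
    case Inner
    then have "A = {}" using k by (auto simp: slab_facets_def)
    then show ?thesis using Inner eJ by (intro bexI[of _ "Upper e"]) auto
  next
    case Outer
    then have "A' = UNIV" using k by (auto simp: slab_facets_def)
    then have "(\<Sum>i\<in>A'. x $ i) \<noteq> 1" if "x \<in> base_polytope (slab_bases r A A')" for x
      using poly(3)[OF that] b(1) by simp
    then show ?thesis using Outer eJ by (intro bexI[of _ "Upper e"]) auto
  qed
qed

lemma card_maximal_proper_faces_slab:
  fixes A A' :: "'n::finite set"
  assumes P: "proper_slab r A A'"
  shows "card (maximal_proper_faces (base_polytope (slab_bases r A A'))) = card (slab_facets r A A')"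
proof (rule card_maximal_proper_faces[where I = UNIV and a = "slab_normal A A'" and b = slab_offset])
  note sub = slab_subset[OF P]
  show eq: "base_polytope (slab_bases r A A') = {x. (\<Sum>i\<in>UNIV. axis i 1) \<bullet> x = real r \<and>
     (\<forall>k\<in>UNIV. slab_normal A A' k \<bullet> x \<le> slab_offset k)}"
    by (rule base_polytope_slab_ineqs[OF sub])
  have mem: "x \<in> base_polytope (slab_bases r A A')"
    if "(\<Sum>i\<in>UNIV. x $ i) = real r" "\<And>k. slab_normal A A' k \<bullet> x \<le> slab_offset k" for x
    using that unfolding eq by (auto simp: inner_axis' inner_sum_left)
  obtain e where "e \<in> A'" "e \<notin> A" using slab_blocks(2)[OF P] by blast
  then show "slab_facets r A A' \<noteq> {}" by (auto simp: slab_facets_def)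
  show "\<exists>x\<in>base_polytope (slab_bases r A A'). slab_normal A A' k \<bullet> x < slab_offset k" for k
  proof -
    obtain x where x: "(\<Sum>i\<in>UNIV. x $ i) = real r" "\<And>i. 0 < x $ i \<and> x $ i < 1"
      "(\<Sum>i\<in>A. x $ i) < 1" "1 < (\<Sum>i\<in>A'. x $ i)" using slab_interior_point[OF P] by blast
    then have "slab_normal A A' l \<bullet> x < slab_offset l" for l by (cases l) auto
    then show ?thesis using mem[OF x(1)] less_imp_le by blast
  qed
  show "\<exists>x\<in>base_polytope (slab_bases r A A'). slab_normal A A' k \<bullet> x = slab_offset k \<and>
      (\<forall>l\<in>slab_facets r A A' - {k}. slab_normal A A' l \<bullet> x < slab_offset l)"
    if k: "k \<in> slab_facets r A A'" for k
  proof -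
    obtain x where x: "(\<Sum>i\<in>UNIV. x $ i) = real r" "slab_normal A A' k \<bullet> x = slab_offset k"
      "\<And>l. l \<noteq> k \<Longrightarrow> slab_normal A A' l \<bullet> x < slab_offset l" using slab_tight_point[OF P k] by blast
    have "slab_normal A A' l \<bullet> x \<le> slab_offset l" for l
      using x(2) x(3)[of l] by (cases "l = k") auto
    then show ?thesis using mem[OF x(1)] x by (intro bexI[of _ x]) auto
  qed
  show "\<exists>l\<in>slab_facets r A A'. \<forall>x\<in>base_polytope (slab_bases r A A').
      slab_normal A A' k \<bullet> x = slab_offset k \<longrightarrow> slab_normal A A' l \<bullet> x = slab_offset l"
    if "k \<in> UNIV - slab_facets r A A'" for k
    using slab_redundant[OF P, of k] that by blast
qed auto

lemma card_slab_facets: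
  fixes A A' :: "'n::finite set"
  assumes P: "proper_slab r A A'"
  shows "card (slab_facets r A A') + (if roomy_slab r A A' then 0 else card (A' - A)) =
    CARD('n) + card (A' - A) + (if 3 \<le> r then card (- A') else 0) +
    of_bool (A \<noteq> {}) + of_bool (A' \<noteq> UNIV)"
proof -
  note b = slab_blocks[OF P]
  let ?Z = "{i. i \<in> A' - A \<longrightarrow> roomy_slab r A A'}"
  let ?O = "{i. i \<notin> A \<and> (i \<in> A' \<or> 3 \<le> r)}"
  let ?T = "{k :: 'n slab_ineq. k = Inner \<and> A \<noteq> {} \<or> k = Outer \<and> A' \<noteq> UNIV}"
  have "card (slab_facets r A A') = card (Lower ` ?Z) + card (Upper ` ?O) + card ?T"
    unfolding slab_facets_def by (subst card_Un_disjoint; auto)+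
  moreover have "card (Lower ` ?Z) = card ?Z" "card (Upper ` ?O) = card ?O"
    by (auto intro!: card_image inj_onI)
  moreover have "card ?T = of_bool (A \<noteq> {}) + of_bool (A' \<noteq> UNIV)"
  proof -
    have "?T = (if A \<noteq> {} then {Inner} else {}) \<union> (if A' \<noteq> UNIV then {Outer} else {})" by auto
    then show ?thesis by simp
  qed
  moreover have "card ?Z + (if roomy_slab r A A' then 0 else card (A' - A)) = CARD('n)"
  proof (cases "roomy_slab r A A'")
    case False
    then have "?Z = - (A' - A)" by auto
    moreover have "card (- X) + card X = CARD('n)" for X :: "'n set"
      using card_Un_disjoint[of "- X" X] by simp
    ultimately show ?thesis using False by (simp only: if_False)
  qed simp
  moreover have "card ?O = card (A' - A) + (if 3 \<le> r then card (- A') else 0)"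
  proof -
    have "?O = (A' - A) \<union> (if 3 \<le> r then - A' else {})" using b(2) by auto
    moreover have "card \<dots> = card (A' - A) + card (if 3 \<le> r then - A' else {})"
      by (intro card_Un_disjoint) auto
    ultimately show ?thesis by simp
  qed
  ultimately show ?thesis by simp
qed

section \<open>Cutting the hypersimplex along nested sets\<close>

lemma base_polytope_uniform_bases:
  "base_polytope (uniform_bases UNIV r) = {x. (\<forall>i. 0 \<le> x $ i \<and> x $ i \<le> 1) \<and> (\<Sum>i\<in>UNIV. x $ i) = real r}"
proof -
  have "uniform_bases UNIV r = chain_bases {(UNIV, r, r)}"
    by (auto simp: uniform_bases_def chain_bases_def)
  moreover have "chain_constraints {(UNIV, r, r)} r" by (simp add: chain_constraints_def)
  ultimately have "base_polytope (uniform_bases UNIV r) = chain_polytope {(UNIV, r, r)}"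
    using base_polytope_chain_bases by metis
  then show ?thesis by (auto simp: chain_polytope_def)
qed

text \<open>From an interior point of the slab a small step towards any point of the hypersimplex stays in the
  slab, so both have the same affine hull.\<close>

lemma aff_dim_slab:
  fixes A A' :: "'n::finite set"
  assumes P: "proper_slab r A A'"
  shows "aff_dim (base_polytope (slab_bases r A A')) = aff_dim (base_polytope (uniform_bases (UNIV :: 'n set) r))"
    (is "aff_dim ?Q = aff_dim ?D")
proof (rule antisym)
  note sub = slab_subset[OF P]
  show "aff_dim ?Q \<le> aff_dim ?D"
    by (intro aff_dim_subset) (auto simp: base_polytope_slab_bases[OF sub] base_polytope_uniform_bases)
  obtain y :: "real^'n" where y: "(\<Sum>i\<in>UNIV. y $ i) = real r" "\<And>i. 0 < y $ i \<and> y $ i < 1"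
    "(\<Sum>i\<in>A. y $ i) < 1" "1 < (\<Sum>i\<in>A'. y $ i)" using slab_interior_point[OF P] by blast
  have yk: "slab_normal A A' k \<bullet> y < slab_offset k" for k by (cases k) (use y in auto)
  have mem: "x \<in> ?Q \<longleftrightarrow> (\<Sum>i\<in>UNIV. axis i 1) \<bullet> x = real r \<and>
     (\<forall>k\<in>UNIV. slab_normal A A' k \<bullet> x \<le> slab_offset k)" for x
    unfolding base_polytope_slab_ineqs[OF sub] by simp
  have yQ: "y \<in> ?Q" using y yk by (simp add: mem inner_sum_left inner_axis' less_imp_le)
  have "?D \<subseteq> affine hull ?Q"
  proof
    fix p assume "p \<in> ?D"
    then have p: "(\<Sum>i\<in>UNIV. p $ i) = real r" by (simp add: base_polytope_uniform_bases)
    have "\<forall>\<^sub>F e in at_right 0. slab_normal A A' k \<bullet> (y + e *\<^sub>R (p - y)) < slab_offset k" for k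
    proof -
      have "((\<lambda>e. slab_normal A A' k \<bullet> (y + e *\<^sub>R (p - y))) \<longlongrightarrow>
          slab_normal A A' k \<bullet> (y + 0 *\<^sub>R (p - y))) (at_right 0)"
        by (intro tendsto_intros)
      then show ?thesis using yk[of k] by (auto dest: order_tendstoD(2))
    qed
    then have "\<forall>\<^sub>F e in at_right 0. \<forall>k\<in>UNIV. slab_normal A A' k \<bullet> (y + e *\<^sub>R (p - y)) < slab_offset k"
      by (intro eventually_ball_finite) auto
    then have "\<forall>\<^sub>F e in at_right 0. e > 0 \<and> (\<forall>k\<in>UNIV. slab_normal A A' k \<bullet> (y + e *\<^sub>R (p - y)) < slab_offset k)"
      by (rule eventually_conj[OF eventually_at_right_less])
    from eventually_happens'[OF trivial_limit_at_right_real this] obtain e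
      where e: "e > 0" "\<And>k. slab_normal A A' k \<bullet> (y + e *\<^sub>R (p - y)) < slab_offset k" by blast
    define q where "q = y + e *\<^sub>R (p - y)"
    have "(\<Sum>i\<in>UNIV. q $ i) = real r"
      using p y(1) by (simp add: q_def sum.distrib sum_subtractf flip: sum_distrib_left)
    then have "q \<in> ?Q" using e(2) by (simp add: mem q_def inner_sum_left inner_axis' less_imp_le)
    then have "y \<in> affine hull ?Q" "q \<in> affine hull ?Q" using yQ by (simp_all add: hull_inc)
    then have "(1 - 1 / e) *\<^sub>R y + (1 / e) *\<^sub>R q \<in> affine hull ?Q"
      by (intro mem_affine affine_affine_hull) auto
    moreover have "(1 - 1 / e) *\<^sub>R y + (1 / e) *\<^sub>R q = p"
      using e(1) by (simp add: q_def scaleR_add_right scaleR_diff_left)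
    ultimately show "p \<in> affine hull ?Q" by simp
  qed
  then show "aff_dim ?D \<le> aff_dim ?Q" using aff_dim_subset[of ?D "affine hull ?Q"] by (simp add: aff_dim_affine_hull)
qed

lemma matroid_bases_slab:
  fixes A A' :: "'n::finite set"
  assumes P: "proper_slab r A A'"
  shows "matroid_bases UNIV (slab_bases r A A')"
  unfolding slab_bases_def
proof (rule matroid_bases_chain)
  show "chain_constraints (slab_constraints r A A') r"
    using slab_subset[OF P] by (auto simp: chain_constraints_def slab_constraints_def)
  obtain y :: "real^'n" where y: "(\<Sum>i\<in>UNIV. y $ i) = real r" "\<And>i. 0 < y $ i \<and> y $ i < 1"
    "(\<Sum>i\<in>A. y $ i) < 1" "1 < (\<Sum>i\<in>A'. y $ i)" using slab_interior_point[OF P] by blast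
  then have "y \<in> base_polytope (slab_bases r A A')"
    by (simp add: base_polytope_slab_bases[OF slab_subset[OF P]] less_imp_le)
  then show "chain_bases (slab_constraints r A A') \<noteq> {}"
    unfolding slab_bases_def base_polytope_def by auto
qed

definition nested_cuts :: "nat \<Rightarrow> nat \<Rightarrow> (nat \<Rightarrow> 'n::finite set) \<Rightarrow> bool" where
  "nested_cuts r t A \<longleftrightarrow> 2 \<le> r \<and> 2 \<le> t \<and> A 0 = {} \<and> A t = UNIV \<and> (\<forall>j<t. A j \<subset> A (Suc j)) \<and>
     2 \<le> card (A 1) \<and> r \<le> card (- A (t - 1))"

lemma nested_cuts_mono:
  assumes N: "nested_cuts r t A" and "i \<le> j" "j \<le> t"
  shows "A i \<subseteq> A j"
  using assms(2,3)
proof (induction rule: dec_induct)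
  case (step k)
  then have "A k \<subset> A (Suc k)" using N by (simp add: nested_cuts_def)
  then show ?case using step by auto
qed simp

lemma nested_cuts_proper_slab:
  fixes A :: "nat \<Rightarrow> 'n::finite set"
  assumes N: "nested_cuts r t A" and j: "1 \<le> j" "j \<le> t"
  shows "proper_slab r (A (j - 1)) (A j)"
proof -
  have n: "2 \<le> r" "2 \<le> t" "A 0 = {}" "A t = UNIV" "2 \<le> card (A 1)" "r \<le> card (- A (t - 1))"
    "\<And>j. j < t \<Longrightarrow> A j \<subset> A (Suc j)" using N by (auto simp: nested_cuts_def)
  have inner: "j = 1 \<or> 2 \<le> card (A (j - 1))"
  proof (cases "j = 1")
    case False
    then have "A 1 \<subseteq> A (j - 1)" using j by (intro nested_cuts_mono[OF N]) auto
    then show ?thesis using n(5) card_mono[of "A (j - 1)" "A 1"] by simp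
  qed simp
  have outer: "j = t \<or> r \<le> card (- A j)"
  proof (cases "j = t")
    case False
    then have "A j \<subseteq> A (t - 1)" using j by (intro nested_cuts_mono[OF N]) auto
    then show ?thesis using n(6) card_mono[of "- A j" "- A (t - 1)"] by simp
  qed simp
  have "- A j \<noteq> {}" if "j \<noteq> t" using outer that n(1) by auto
  then have "A j \<noteq> UNIV" if "j \<noteq> t" using that by auto
  moreover have "A (j - 1) \<noteq> {}" if "j \<noteq> 1" using inner that by auto
  moreover have "A (j - 1) \<subset> A j" using n(7)[of "j - 1"] j by simp
  ultimately show ?thesis
    using n inner outer unfolding proper_slab_def by (cases "j = 1"; cases "j = t") auto
qed

text \<open>A point lies in the slab of the first index \<open>j\<close> with \<open>1 \<le> x(A_j)\<close>. If a point lies in the slabs \<open>i < j\<close>,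
  then \<open>1 \<le> x(A_i) \<le> x(A_(j-1)) \<le> 1\<close>. Conversely, for a point of the slab \<open>i\<close> the equation
  \<open>x(A_(j-1)) = 1\<close> is enough for it to lie in the slab \<open>j\<close>, and for a point of the slab \<open>j\<close> the equation
  \<open>x(A_i) = 1\<close> is enough for it to lie in the slab \<open>i\<close>. Both are supporting hyperplanes.\<close>

lemma base_decomposition_nested:
  fixes A :: "nat \<Rightarrow> 'n::finite set"
  assumes N: "nested_cuts r t A"
  shows "base_decomposition t (uniform_bases UNIV r) (\<lambda>j\<in>{1..t}. slab_bases r (A (j - 1)) (A j))"
proof -
  let ?P = "\<lambda>j. base_polytope (slab_bases r (A (j - 1)) (A j))"
  have n: "2 \<le> r" "A 0 = {}" "A t = UNIV" using N by (auto simp: nested_cuts_def)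
  have proper: "proper_slab r (A (j - 1)) (A j)" if "j \<in> {1..t}" for j
    using nested_cuts_proper_slab[OF N] that by simp
  have Pj: "x \<in> ?P j \<longleftrightarrow> (\<forall>i. 0 \<le> x $ i \<and> x $ i \<le> 1) \<and> (\<Sum>i\<in>UNIV. x $ i) = real r \<and>
      (\<Sum>i\<in>A (j - 1). x $ i) \<le> 1 \<and> 1 \<le> (\<Sum>i\<in>A j. x $ i)" if "j \<in> {1..t}" for j x
    using base_polytope_slab_bases[OF slab_subset[OF proper[OF that]]] by simp
  have mono: "(\<Sum>i\<in>A j. x $ i) \<le> (\<Sum>i\<in>A k. x $ i)" if "j \<le> k" "k \<le> t" "\<forall>i. 0 \<le> x $ i"
    for j k and x :: "real^'n"
    using nested_cuts_mono[OF N that(1,2)] that(3) by (intro sum_mono2) auto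
  have union: "base_polytope (uniform_bases UNIV r) = (\<Union>j\<in>{1..t}. ?P j)"
  proof
    show "(\<Union>j\<in>{1..t}. ?P j) \<subseteq> base_polytope (uniform_bases UNIV r)"
    proof
      fix x assume "x \<in> (\<Union>j\<in>{1..t}. ?P j)"
      then obtain j where "j \<in> {1..t}" "x \<in> ?P j" by blast
      then show "x \<in> base_polytope (uniform_bases UNIV r)"
        unfolding base_polytope_uniform_bases using Pj by blast
    qed
    show "base_polytope (uniform_bases UNIV r) \<subseteq> (\<Union>j\<in>{1..t}. ?P j)"
    proof
      fix x :: "real^'n" assume "x \<in> base_polytope (uniform_bases UNIV r)"
      then have x: "\<forall>i. 0 \<le> x $ i \<and> x $ i \<le> 1" "(\<Sum>i\<in>UNIV. x $ i) = real r"
        by (auto simp: base_polytope_uniform_bases)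
      define j where "j = (LEAST j. 1 \<le> (\<Sum>i\<in>A j. x $ i))"
      have t: "1 \<le> (\<Sum>i\<in>A t. x $ i)" using x n by simp
      then have j1: "1 \<le> (\<Sum>i\<in>A j. x $ i)" and jt: "j \<le> t"
        unfolding j_def by (rule LeastI, rule Least_le)
      have "j \<noteq> 0" using j1 n(2) by (auto intro: ccontr)
      then have "(\<Sum>i\<in>A (j - 1). x $ i) < 1"
        using not_less_Least[of "j - 1" "\<lambda>j. 1 \<le> (\<Sum>i\<in>A j. x $ i)"] unfolding j_def[symmetric] by simp
      then have "x \<in> ?P j" using x j1 jt \<open>j \<noteq> 0\<close> by (subst Pj) auto
      then show "x \<in> (\<Union>j\<in>{1..t}. ?P j)" using jt \<open>j \<noteq> 0\<close> by (intro UN_I[of j]) auto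
    qed
  qed
  have conv: "convex (?P j)" for j by (simp add: base_polytope_def)
  have pair: "?P i \<noteq> ?P j \<and> ?P i \<inter> ?P j face_of ?P i \<and> ?P i \<inter> ?P j face_of ?P j"
    if i: "i \<in> {1..t}" and j: "j \<in> {1..t}" and ij: "i < j" for i j
  proof (intro conjI)
    have le: "i \<le> j - 1" "j - 1 \<le> t" "i - 1 \<le> i" "i \<le> t" "j - 1 \<le> j" "j \<le> t" using i j ij by auto
    obtain y :: "real^'n" where y: "(\<Sum>i\<in>UNIV. y $ i) = real r" "\<And>i. 0 < y $ i \<and> y $ i < 1"
      "(\<Sum>i\<in>A (i - 1). y $ i) < 1" "1 < (\<Sum>i\<in>A i. y $ i)" using slab_interior_point[OF proper[OF i]] by blast
    have "y \<in> ?P i" unfolding Pj[OF i] using y by (simp add: less_imp_le)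
    moreover have "y \<notin> ?P j" unfolding Pj[OF j] using y(2,4) mono[OF le(1,2), of y] by (auto simp: less_imp_le)
    ultimately show "?P i \<noteq> ?P j" by metis
    have "?P i \<inter> ?P j = ?P i \<inter> {x. (\<Sum>k\<in>A (j - 1). axis k 1) \<bullet> x = 1}"
    proof -
      have "x \<in> ?P j \<longleftrightarrow> (\<Sum>k\<in>A (j - 1). x $ k) = 1" if x: "x \<in> ?P i" for x
        using x mono[OF le(1,2), of x] mono[OF le(5,6), of x] unfolding Pj[OF i] Pj[OF j] by auto
      then show ?thesis by (auto simp: inner_sum_left inner_axis')
    qed
    also have "\<dots> face_of ?P i"
    proof (intro face_of_Int_supporting_hyperplane_ge conv)
      fix x assume x: "x \<in> ?P i"
      then show "(\<Sum>k\<in>A (j - 1). axis k 1) \<bullet> x \<ge> 1"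
        using mono[OF le(1,2), of x] unfolding Pj[OF i] inner_sum_left inner_axis' by auto
    qed
    finally show "?P i \<inter> ?P j face_of ?P i" .
    have "?P i \<inter> ?P j = ?P j \<inter> {x. (\<Sum>k\<in>A i. axis k 1) \<bullet> x = 1}"
    proof -
      have "x \<in> ?P i \<longleftrightarrow> (\<Sum>k\<in>A i. x $ k) = 1" if x: "x \<in> ?P j" for x
        using x mono[OF le(1,2), of x] mono[OF le(3,4), of x] unfolding Pj[OF i] Pj[OF j] by auto
      then show ?thesis by (auto simp: inner_sum_left inner_axis')
    qed
    also have "\<dots> face_of ?P j"
    proof (intro face_of_Int_supporting_hyperplane_le conv)
      fix x assume x: "x \<in> ?P j"
      then show "(\<Sum>k\<in>A i. axis k 1) \<bullet> x \<le> 1"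
        using mono[OF le(1,2), of x] unfolding Pj[OF j] inner_sum_left inner_axis' by auto
    qed
    finally show "?P i \<inter> ?P j face_of ?P j" .
  qed
  have "?P i \<noteq> ?P j \<and> ?P i \<inter> ?P j face_of ?P i \<and> ?P i \<inter> ?P j face_of ?P j"
    if "i \<in> {1..t}" "j \<in> {1..t}" "i \<noteq> j" for i j
    using pair[of i j] pair[of j i] that by (cases i j rule: linorder_cases) (auto simp: Int_commute simp del: atLeastAtMost_iff)
  then show ?thesis
    unfolding base_decomposition_def using union proper
    by (auto simp: matroid_bases_slab aff_dim_slab simp del: atLeastAtMost_iff)
qed

section \<open>Duality\<close>

lemma matroid_bases_card_le:
  assumes M: "matroid_bases E \<B>" and "A \<in> \<B>" "B \<in> \<B>"
  shows "card A \<le> card B"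
  using assms(2)
proof (induction "card (A - B)" arbitrary: A rule: less_induct)
  case less
  have fin: "finite X" if "X \<in> \<B>" for X
    using M that unfolding matroid_bases_def by (meson PowD finite_subset subsetD)
  show ?case
  proof (cases "A - B = {}")
    case True
    then show ?thesis using fin[OF assms(3)] by (intro card_mono) auto
  next
    case False
    then obtain x where x: "x \<in> A - B" by blast
    then obtain y where y: "y \<in> B - A" "insert y (A - {x}) \<in> \<B>"
      using M less.prems assms(3) unfolding matroid_bases_def by blast
    have "insert y (A - {x}) - B = (A - B) - {x}" using y by auto
    then have "card (insert y (A - {x}) - B) < card (A - B)"
      using x fin[OF less.prems] by (intro psubset_card_mono) auto
    then have "card (insert y (A - {x})) \<le> card B" using less.hyps y by blast
    moreover have "card (insert y (A - {x})) = card A"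
      using x y fin[OF less.prems] by (intro card_swap) auto
    ultimately show ?thesis by simp
  qed
qed

text \<open>Start with \<open>C = B\<close> and exchange its elements outside of \<open>insert x A\<close>, one after the other, for elements
  of \<open>A\<close>. This keeps \<open>x\<close> and \<open>A \<inter> B\<close> inside \<open>C\<close>. In the end \<open>C \<subseteq> insert x A\<close>, and since all bases have
  the same size, \<open>C\<close> arises from \<open>A\<close> by adding \<open>x\<close> and removing one element, which is not in \<open>B\<close>.\<close>

lemma matroid_bases_dual_exchange:
  assumes M: "matroid_bases E \<B>" and A: "A \<in> \<B>" and B: "B \<in> \<B>" and x: "x \<in> B - A"
  shows "\<exists>y\<in>A - B. insert x (A - {y}) \<in> \<B>"
proof -
  have fin: "finite X" if "X \<in> \<B>" for X
    using M that unfolding matroid_bases_def by (meson PowD finite_subset subsetD)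
  have "\<exists>y\<in>A - B. insert x (A - {y}) \<in> \<B>" if "C \<in> \<B>" "x \<in> C" "A \<inter> B \<subseteq> C" for C
    using that
  proof (induction "card (C - insert x A)" arbitrary: C rule: less_induct)
    case less
    show ?case
    proof (cases "C \<subseteq> insert x A")
      case True
      have "card C = card A" using matroid_bases_card_le[OF M] less.prems(1) A by (simp add: order_antisym)
      have "\<not> A \<subseteq> C"
      proof
        assume "A \<subseteq> C"
        then have "A \<subset> C" using less.prems(2) x by auto
        then have "card A < card C" using fin[OF less.prems(1)] by (intro psubset_card_mono)
        then show False using \<open>card C = card A\<close> by simp
      qed
      then obtain y where y: "y \<in> A" "y \<notin> C" by blast
      have "card (insert x (A - {y})) = card A"
        using x y fin[OF A] by (intro card_swap) auto
      moreover have "C \<subseteq> insert x (A - {y})" using True y by auto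
      ultimately have "C = insert x (A - {y})"
        using fin[OF A] \<open>card C = card A\<close> by (intro card_subset_eq) auto
      then show ?thesis using less.prems y by blast
    next
      case False
      then obtain z where z: "z \<in> C" "z \<noteq> x" "z \<notin> A" by blast
      then obtain w where w: "w \<in> A - C" "insert w (C - {z}) \<in> \<B>"
        using M less.prems(1) A unfolding matroid_bases_def by blast
      have "insert w (C - {z}) - insert x A = (C - insert x A) - {z}" using w by auto
      then have "card (insert w (C - {z}) - insert x A) < card (C - insert x A)"
        using z fin[OF less.prems(1)] by (intro psubset_card_mono) auto
      moreover have "x \<in> insert w (C - {z})" "A \<inter> B \<subseteq> insert w (C - {z})" using z less.prems by auto
      ultimately show ?thesis using less.hyps w(2) by blast
    qed
  qed
  then show ?thesis using B x by blast
qed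

lemma matroid_bases_dual:
  assumes M: "matroid_bases (UNIV :: 'a set) \<B>"
  shows "matroid_bases UNIV (uminus ` \<B>)"
  unfolding matroid_bases_def
proof (intro conjI ballI)
  show "finite (UNIV :: 'a set)" "uminus ` \<B> \<noteq> {}" using M by (auto simp: matroid_bases_def)
  show "uminus ` \<B> \<subseteq> Pow UNIV" by simp
  fix X Y x assume "X \<in> uminus ` \<B>" "Y \<in> uminus ` \<B>" and x: "x \<in> X - Y"
  then obtain A B where AB: "A \<in> \<B>" "B \<in> \<B>" "X = - A" "Y = - B" by blast
  then obtain y where y: "y \<in> A - B" "insert x (A - {y}) \<in> \<B>"
    using matroid_bases_dual_exchange[OF M, of A B x] x by auto
  have "- insert x (A - {y}) = insert y (X - {x})" using AB x y by auto
  then have "insert y (X - {x}) \<in> uminus ` \<B>" using y(2) by (metis imageI)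
  then show "\<exists>y\<in>Y - X. insert y (X - {x}) \<in> uminus ` \<B>" using y AB by auto
qed

text \<open>The indicator vector of \<open>- B\<close> is \<open>1 - x\<close> if \<open>x\<close> is that of \<open>B\<close>.\<close>

lemma base_polytope_dual:
  fixes \<B> :: "'n::finite set set"
  shows "base_polytope (uminus ` \<B>) = (\<lambda>x. 1 - x) ` base_polytope \<B>"
proof -
  have lin: "linear (uminus :: real^'n \<Rightarrow> real^'n)" by (simp add: linear_iff)
  have "(\<Sum>i\<in>- B. axis i 1) = (1 :: real^'n) + - (\<Sum>i\<in>B. axis i 1)" for B :: "'n set"
    by (simp add: vec_eq_iff axis_def if_distrib cong: if_cong)
  then have "(\<lambda>B. \<Sum>i\<in>B. axis i 1 :: real^'n) ` uminus ` \<B> =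
      (+) 1 ` uminus ` (\<lambda>B. \<Sum>i\<in>B. axis i 1) ` \<B>"
    by (simp add: image_image)
  then have "base_polytope (uminus ` \<B>) = (+) 1 ` uminus ` base_polytope \<B>"
    unfolding base_polytope_def
    by (simp only: convex_hull_translation convex_hull_linear_image[OF lin])
  then show ?thesis by (simp add: image_image)
qed

lemma face_of_reflection:
  "(\<lambda>x. c - x) ` F face_of (\<lambda>x. c - x) ` P \<longleftrightarrow> F face_of (P :: 'a::euclidean_space set)"
proof -
  have e: "(\<lambda>x. c - x) ` S = (+) c ` uminus ` S" for S :: "'a set" by (simp add: image_image)
  have lin: "linear (uminus :: 'a \<Rightarrow> 'a)" by (simp add: linear_iff)
  show ?thesis unfolding e face_of_translation_eq by (rule face_of_linear_image[OF lin]) simp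
qed

lemma aff_dim_reflection: "aff_dim ((\<lambda>x. c - x) ` P) = aff_dim (P :: 'a::euclidean_space set)"
proof -
  have e: "(\<lambda>x. c - x) ` S = (+) c ` uminus ` S" for S :: "'a set" by (simp add: image_image)
  have lin: "linear (uminus :: 'a \<Rightarrow> 'a)" by (simp add: linear_iff)
  show ?thesis unfolding e aff_dim_translation_eq by (rule aff_dim_injective_linear_image[OF lin]) simp
qed

lemma combinatorially_equivalent_reflection:
  "combinatorially_equivalent P ((\<lambda>x. c - x) ` (P :: 'a::euclidean_space set))"
proof -
  let ?\<rho> = "\<lambda>x. c - x"
  have inj: "inj ?\<rho>" by (auto intro: injI)
  have "bij_betw ((`) ?\<rho>) {F. F face_of P} {G. G face_of ?\<rho> ` P}"
  proof (rule bij_betwI[where g = "(`) ?\<rho>"])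
    show "(`) ?\<rho> \<in> {F. F face_of P} \<rightarrow> {G. G face_of ?\<rho> ` P}" by (simp add: face_of_reflection)
    show "(`) ?\<rho> \<in> {G. G face_of ?\<rho> ` P} \<rightarrow> {F. F face_of P}"
    proof
      fix G assume "G \<in> {G. G face_of ?\<rho> ` P}"
      then have "?\<rho> ` ?\<rho> ` G face_of ?\<rho> ` P" by (simp add: image_image)
      then show "?\<rho> ` G \<in> {F. F face_of P}" by (simp only: face_of_reflection mem_Collect_eq)
    qed
  qed (simp_all add: image_image)
  then show ?thesis unfolding combinatorially_equivalent_def
    by (intro exI[of _ "(`) ?\<rho>"]) (simp add: inj_image_subset_iff[OF inj])
qed

lemma base_decomposition_dual:
  fixes M :: "nat \<Rightarrow> 'n::finite set set"
  assumes D: "base_decomposition t \<B> M"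
  shows "base_decomposition t (uminus ` \<B>) (\<lambda>i\<in>{1..t}. uminus ` M i)"
proof -
  let ?\<rho> = "\<lambda>x :: real^'n. 1 - x"
  have inj: "inj ?\<rho>" by (auto intro: injI)
  have d: "\<And>i. i \<in> {1..t} \<Longrightarrow> matroid_bases UNIV (M i)"
    "base_polytope \<B> = (\<Union>i\<in>{1..t}. base_polytope (M i))"
    "\<And>i. i \<in> {1..t} \<Longrightarrow> aff_dim (base_polytope (M i)) = aff_dim (base_polytope \<B>)"
    "\<And>i j. i \<in> {1..t} \<Longrightarrow> j \<in> {1..t} \<Longrightarrow> i \<noteq> j \<Longrightarrow> base_polytope (M i) \<noteq> base_polytope (M j) \<and>
       base_polytope (M i) \<inter> base_polytope (M j) face_of base_polytope (M i) \<and>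
       base_polytope (M i) \<inter> base_polytope (M j) face_of base_polytope (M j)"
    using D unfolding base_decomposition_def by (auto simp del: atLeastAtMost_iff)
  show ?thesis
    unfolding base_decomposition_def
  proof (intro conjI ballI impI)
    show "(\<lambda>i\<in>{1..t}. uminus ` M i) \<in> {1..t} \<rightarrow>\<^sub>E {\<C>. matroid_bases UNIV \<C>}"
      using d(1) by (simp add: matroid_bases_dual)
    show "base_polytope (uminus ` \<B>) = (\<Union>i\<in>{1..t}. base_polytope ((\<lambda>i\<in>{1..t}. uminus ` M i) i))"
      using d(2) by (simp add: base_polytope_dual image_UN)
    fix i assume i: "i \<in> {1..t}"
    then show "aff_dim (base_polytope ((\<lambda>i\<in>{1..t}. uminus ` M i) i)) = aff_dim (base_polytope (uminus ` \<B>))"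
      using d(3)[OF i] by (simp add: base_polytope_dual aff_dim_reflection)
    fix j assume j: "j \<in> {1..t}" and "i \<noteq> j"
    note ij = d(4)[OF i j \<open>i \<noteq> j\<close>]
    show "base_polytope ((\<lambda>i\<in>{1..t}. uminus ` M i) i) \<noteq> base_polytope ((\<lambda>i\<in>{1..t}. uminus ` M i) j)"
      using i j ij inj by (simp add: base_polytope_dual inj_image_eq_iff)
    show "base_polytope ((\<lambda>i\<in>{1..t}. uminus ` M i) i) \<inter> base_polytope ((\<lambda>i\<in>{1..t}. uminus ` M i) j)
        face_of base_polytope ((\<lambda>i\<in>{1..t}. uminus ` M i) i)"
      "base_polytope ((\<lambda>i\<in>{1..t}. uminus ` M i) i) \<inter> base_polytope ((\<lambda>i\<in>{1..t}. uminus ` M i) j)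
        face_of base_polytope ((\<lambda>i\<in>{1..t}. uminus ` M i) j)"
      using i j ij by (simp_all add: base_polytope_dual face_of_reflection flip: image_Int[OF inj])
  qed
qed

lemma uniform_bases_dual:
  assumes "r \<le> CARD('n)"
  shows "uminus ` uniform_bases (UNIV :: 'n::finite set) r = uniform_bases UNIV (CARD('n) - r)"
proof -
  have c: "card (- B) = CARD('n) - card B" for B :: "'n set"
    by (simp add: Compl_eq_Diff_UNIV card_Diff_subset)
  have "B \<in> uminus ` uniform_bases UNIV r" if "B \<in> uniform_bases UNIV (CARD('n) - r)" for B :: "'n set"
    using that assms by (intro image_eqI[of _ _ "- B"]) (auto simp: uniform_bases_def c)
  then show ?thesis by (auto simp: uniform_bases_def c)
qed

section \<open>Recovering a partition from numbers of facets\<close>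

text \<open>The number by which the facets of the slab with index \<open>j\<close> fall short of \<open>2 n + 2\<close>, where \<open>\<alpha> k\<close> is the
  cardinality of the set with index \<open>k\<close>. Its main term is \<open>\<alpha> (j - 1)\<close>. The extreme slabs have
  only one of the two hyperplanes, and each \<open>of_bool\<close> stands for one of the redundancies that occur when
  a block has its least admissible size or when the rank is 2.\<close>

definition facet_deficit :: "nat \<Rightarrow> nat \<Rightarrow> nat \<Rightarrow> (nat \<Rightarrow> nat) \<Rightarrow> nat \<Rightarrow> nat" where
  "facet_deficit n r t \<alpha> j =
     (if j = 1 then 1 + 2 * of_bool (\<alpha> 1 = 2) + of_bool (r = 2) * (n - \<alpha> 1)
      else if j < t then \<alpha> (j - 1) + of_bool (\<alpha> j = \<alpha> (j - 1) + 1)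
      else \<alpha> (j - 1) + 1 + r * of_bool (\<alpha> (j - 1) + r = n))"

text \<open>In rank 2 a partition into \<open>t \<le> r\<close> parts has only two of them. The two slabs then play
  symmetric roles, so \<open>2 * \<alpha> 1 \<le> n\<close> is what singles out one of the sizes \<open>\<alpha> 1\<close> and \<open>n - \<alpha> 1\<close>.\<close>

definition cut_sizes :: "nat \<Rightarrow> nat \<Rightarrow> nat \<Rightarrow> (nat \<Rightarrow> nat) \<Rightarrow> bool" where
  "cut_sizes n r t \<alpha> \<longleftrightarrow> 2 \<le> r \<and> 2 \<le> t \<and> \<alpha> 0 = 0 \<and> \<alpha> t = n \<and> (\<forall>j<t. \<alpha> j < \<alpha> (Suc j)) \<and>
     2 \<le> \<alpha> 1 \<and> \<alpha> (t - 1) + r \<le> n \<and> (r = 2 \<longrightarrow> t = 2 \<and> 2 * \<alpha> 1 \<le> n)"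

lemma cut_sizes_less:
  assumes "cut_sizes n r t \<alpha>" "i < j" "j \<le> t"
  shows "\<alpha> i < \<alpha> j"
  using assms(2,3)
proof (induction j)
  case (Suc j)
  then have "\<alpha> j < \<alpha> (Suc j)" using assms(1) by (simp add: cut_sizes_def)
  then show ?case using Suc by (cases "i = j") auto
qed simp

lemma cut_sizes_ge:
  assumes "cut_sizes n r t \<alpha>" "1 \<le> k" "k \<le> t"
  shows "k + 1 \<le> \<alpha> k"
  using assms(2,3)
proof (induction k rule: dec_induct)
  case base
  then show ?case using assms(1) by (simp add: cut_sizes_def)
next
  case (step k)
  then show ?case using cut_sizes_less[OF assms(1), of k "Suc k"] by simp
qed

text \<open>Let \<open>k\<close> be the last index at which two size sequences differ. Beyond \<open>k + 1\<close> the deficits agree. Up to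
  \<open>k + 1\<close> all deficits of the smaller sequence lie below the value \<open>\<beta> k\<close>, because a deficit with index
  between 2 and \<open>t - 1\<close> is at most \<open>\<alpha> j\<close>, whereas the larger sequence reaches \<open>\<beta> k\<close> at \<open>k + 1\<close>. So the
  numbers of deficits from that threshold on differ. For \<open>k + 1 = t\<close> the threshold is raised by 1,
  since the deficit of the last slab is one larger. Two cases need other thresholds: rank 2,
  and \<open>\<alpha> 1 = 2\<close> with \<open>k = 1\<close>, where the deficit 3 of the first slab may reach \<open>\<beta> 1\<close>.\<close>

lemma facet_deficit_separates:
  assumes A: "cut_sizes n r t \<alpha>" and B: "cut_sizes n r t \<beta>"
    and eq: "\<And>v. card {j\<in>{1..t}. v \<le> facet_deficit n r t \<alpha> j} = card {j\<in>{1..t}. v \<le> facet_deficit n r t \<beta> j}"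
    and k: "1 \<le> k" "k < t" "\<alpha> k < \<beta> k" and agree: "\<And>i. k < i \<Longrightarrow> i \<le> t \<Longrightarrow> \<alpha> i = \<beta> i"
  shows False
proof -
  let ?h = "facet_deficit n r t \<alpha>" and ?g = "facet_deficit n r t \<beta>"
  have a: "2 \<le> r" "2 \<le> t" "\<alpha> 0 = 0" "\<alpha> t = n" "2 \<le> \<alpha> 1" "\<alpha> (t - 1) + r \<le> n" "r = 2 \<longrightarrow> t = 2 \<and> 2 * \<alpha> 1 \<le> n"
    using A by (auto simp: cut_sizes_def)
  have b: "\<beta> 0 = 0" "\<beta> t = n" "2 \<le> \<beta> 1" "\<beta> (t - 1) + r \<le> n" "r = 2 \<longrightarrow> t = 2 \<and> 2 * \<beta> 1 \<le> n"
    using B by (auto simp: cut_sizes_def)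
  have strict: False if "{j\<in>{1..t}. v \<le> ?h j} \<subset> {j\<in>{1..t}. v \<le> ?g j}" for v
    using psubset_card_mono[OF _ that] eq[of v] by simp
  have strict': False if "{j\<in>{1..t}. v \<le> ?g j} \<subset> {j\<in>{1..t}. v \<le> ?h j}" for v
    using psubset_card_mono[OF _ that] eq[of v] by simp
  consider "r = 2" | "r \<noteq> 2" "k = 1" "\<alpha> 1 = 2" | "r \<noteq> 2" "k \<noteq> 1 \<or> \<alpha> 1 \<noteq> 2" by blast
  then show False
  proof cases
    case 1
    then have t: "t = 2" and k1: "k = 1" using a k by auto
    \<comment> \<open>In rank 2 the first deficit of the smaller sequence exceeds both deficits of the larger one.\<close>
    define v where "v = n + 1 - \<alpha> 1"
    have "?g 1 < v" "?g 2 < v"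
      using a b 1 t k k1 by (auto simp: facet_deficit_def v_def)
    moreover have "v \<le> ?h 1" using a 1 t by (auto simp: facet_deficit_def v_def)
    moreover have "{1..t} = {1, 2}" using t by auto
    ultimately have "{j\<in>{1..t}. v \<le> ?g j} = {}" "1 \<in> {j\<in>{1..t}. v \<le> ?h j}" by auto
    then show False using strict'[of v] by blast
  next
    case 2
    have "2 \<le> ?h j" if j: "j \<in> {1..t}" for j
    proof (cases "j = 1")
      case True
      then show ?thesis using 2 by (simp add: facet_deficit_def)
    next
      case False
      then have "j - 1 + 1 \<le> \<alpha> (j - 1)" using j by (intro cut_sizes_ge[OF A]) auto
      then show ?thesis using False j by (auto simp: facet_deficit_def)
    qed
    moreover have "?g 1 < 2" using 2 k by (simp add: facet_deficit_def)
    ultimately have "{j\<in>{1..t}. 2 \<le> ?g j} \<subset> {j\<in>{1..t}. 2 \<le> ?h j}" using a(2) by force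
    then show False by (rule strict')
  next
    case 3
    define v where "v = \<beta> k + of_bool (k + 1 = t)"
    have low: "?h j < v" if j: "1 \<le> j" "j \<le> k" for j
    proof (cases "j = 1")
      case True
      have "k + 1 \<le> \<alpha> k" using k by (intro cut_sizes_ge[OF A]) auto
      then show ?thesis using True 3 k a(5) by (auto simp: facet_deficit_def v_def)
    next
      case False
      then have "\<alpha> (j - 1) < \<alpha> j" using j k by (intro cut_sizes_less[OF A]) auto
      moreover have "\<alpha> j \<le> \<alpha> k" using cut_sizes_less[OF A, of j k] j k by (cases "j = k") auto
      ultimately show ?thesis using False j k by (auto simp: facet_deficit_def v_def)
    qed
    have mid: "?h (k + 1) < v" "v \<le> ?g (k + 1)"
    proof -
      have "\<beta> k < \<beta> (k + 1)" using k by (intro cut_sizes_less[OF B]) auto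
      moreover have "\<alpha> (k + 1) = \<beta> (k + 1)" using agree k by simp
      moreover have "\<beta> k + r \<le> n" if "k + 1 = t" using b(4) that by auto
      ultimately show "?h (k + 1) < v" using k by (auto simp: facet_deficit_def v_def)
      show "v \<le> ?g (k + 1)" using k by (auto simp: facet_deficit_def v_def)
    qed
    have high: "?h j = ?g j" if "k + 1 < j" "j \<le> t" for j
    proof -
      have "\<alpha> j = \<beta> j" "\<alpha> (j - 1) = \<beta> (j - 1)" "j \<noteq> 1" using that agree k by auto
      then show ?thesis by (simp add: facet_deficit_def)
    qed
    have "v \<le> ?g j" if "1 \<le> j" "j \<le> t" "v \<le> ?h j" for j
    proof -
      have "\<not> j \<le> k" using low[of j] that by auto
      moreover have "j \<noteq> k + 1" using mid(1) that by auto
      ultimately show ?thesis using high[of j] that by simp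
    qed
    moreover have "k + 1 \<in> {1..t}" using k by simp
    ultimately have "{j\<in>{1..t}. v \<le> ?h j} \<subset> {j\<in>{1..t}. v \<le> ?g j}" using mid by force
    then show False by (rule strict)
  qed
qed

lemma cut_sizes_determined:
  assumes A: "cut_sizes n r t \<alpha>" and B: "cut_sizes n r t \<beta>"
    and eq: "\<And>v. card {j\<in>{1..t}. v \<le> facet_deficit n r t \<alpha> j} = card {j\<in>{1..t}. v \<le> facet_deficit n r t \<beta> j}"
    and "k \<le> t"
  shows "\<alpha> k = \<beta> k"
proof (rule ccontr)
  define D where "D = {i. i \<le> t \<and> \<alpha> i \<noteq> \<beta> i}"
  assume "\<alpha> k \<noteq> \<beta> k"
  then have D: "finite D" "D \<noteq> {}" using \<open>k \<le> t\<close> by (auto simp: D_def)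
  define m where "m = Max D"
  have m: "m \<le> t" "\<alpha> m \<noteq> \<beta> m" using Max_in[OF D] by (auto simp: D_def m_def)
  have agree: "\<alpha> i = \<beta> i" if "m < i" "i \<le> t" for i
  proof (rule ccontr)
    assume "\<alpha> i \<noteq> \<beta> i"
    then have "i \<in> D" using that by (simp add: D_def)
    then have "i \<le> m" unfolding m_def using D(1) by simp
    then show False using that by simp
  qed
  have "m \<noteq> 0" "m \<noteq> t" using m A B by (auto simp: cut_sizes_def intro: ccontr)
  then have "1 \<le> m" "m < t" using m by auto
  consider "\<alpha> m < \<beta> m" | "\<beta> m < \<alpha> m" using m(2) by linarith
  then show False
  proof cases
    case 1
    show False
      by (rule facet_deficit_separates[OF A B eq \<open>1 \<le> m\<close> \<open>m < t\<close> 1 agree])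
  next
    case 2
    show False
      by (rule facet_deficit_separates[OF B A eq[symmetric] \<open>1 \<le> m\<close> \<open>m < t\<close> 2 agree[symmetric]])
  qed
qed

text \<open>Adding \<open>k - 1\<close> to the sorted parts makes them strictly increasing. The largest part is left out; it is
  determined by \<open>n\<close> and the others.\<close>

definition partition_cuts :: "nat \<Rightarrow> nat \<Rightarrow> nat multiset \<Rightarrow> nat \<Rightarrow> nat" where
  "partition_cuts n t N k = (if k = 0 then 0 else if t \<le> k then n
     else sorted_list_of_multiset N ! (k - 1) + (k - 1))"

text \<open>The last two parts are ordered and the other \<open>t - 2\<close> parts are at least 2, so twice the last
  proper cut is at most \<open>n\<close>. With \<open>2 * r \<le> n\<close> this leaves \<open>r\<close> elements beyond it.\<close>

lemma cut_sizes_partition: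
  assumes N: "size N = t" "\<forall>p\<in>#N. 2 \<le> p" "sum_mset N = n"
    and r: "2 \<le> t" "t \<le> r" "2 * r \<le> n"
  shows "cut_sizes n r t (partition_cuts n t N)"
proof -
  define p where "p = sorted_list_of_multiset N"
  have mp: "mset p = N" by (simp add: p_def)
  have len: "length p = t" using N(1) mp by (metis size_mset)
  have sp: "sorted p" by (simp add: p_def)
  have ge: "2 \<le> p ! i" if "i < t" for i using N(2) mp that len by (metis nth_mem_mset)
  have sum: "(\<Sum>i<t. p ! i) = n"
    using N(3) mp len by (metis sum_mset_sum_list sum_list_sum_nth atLeast0LessThan)
  have c: "partition_cuts n t N k = p ! (k - 1) + (k - 1)" if "1 \<le> k" "k < t" for k
    using that by (simp add: partition_cuts_def p_def)
  have half: "2 * partition_cuts n t N (t - 1) \<le> n"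
  proof -
    obtain s where s: "t = Suc (Suc s)" using r(1) by (metis add_2_eq_Suc le_Suc_ex)
    have "(\<Sum>i<s. 2) \<le> (\<Sum>i<s. p ! i)" using ge s by (intro sum_mono) auto
    moreover have "p ! s \<le> p ! Suc s" using sp len s by (intro sorted_nth_mono) auto
    ultimately have "2 * s + 2 * (p ! s) \<le> n" using sum s by simp
    then show ?thesis using c[of "t - 1"] s by simp
  qed
  have "partition_cuts n t N j < partition_cuts n t N (Suc j)" if j: "j < t" for j
  proof -
    consider "j = 0" | "j \<noteq> 0" "Suc j = t" | "j \<noteq> 0" "Suc j < t" using j by linarith
    then show ?thesis
    proof cases
      case 1
      then show ?thesis using c[of 1] ge[of 0] r by (simp add: partition_cuts_def)
    next
      case 2
      then have "j = t - 1" by simp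
      then show ?thesis using half 2 r by (simp add: partition_cuts_def)
    next
      case 3
      then have "p ! (j - 1) \<le> p ! j" using sp len by (intro sorted_nth_mono) auto
      then show ?thesis using 3 c[of j] c[of "Suc j"] by simp
    qed
  qed
  moreover have "2 \<le> partition_cuts n t N 1" using c[of 1] ge[of 0] r by simp
  moreover have "t = 2" if "r = 2" using that r by simp
  moreover have "2 * partition_cuts n t N 1 \<le> n" if "r = 2" using half \<open>r = 2 \<Longrightarrow> t = 2\<close>[OF that] by simp
  ultimately show ?thesis using r half by (auto simp: cut_sizes_def partition_cuts_def)
qed

lemma partition_cuts_inject:
  assumes N: "size N = t" "sum_mset N = n" and N': "size N' = t" "sum_mset N' = n"
    and eq: "\<And>k. k \<le> t \<Longrightarrow> partition_cuts n t N k = partition_cuts n t N' k"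
  shows "N = N'"
proof -
  define p q where "p = sorted_list_of_multiset N" and "q = sorted_list_of_multiset N'"
  have mp: "mset p = N" "mset q = N'" by (simp_all add: p_def q_def)
  have len: "length p = t" "length q = t" using N(1) N'(1) mp by (metis size_mset)+
  have sum: "(\<Sum>i<t. p ! i) = n" "(\<Sum>i<t. q ! i) = n"
    using N(2) N'(2) mp len by (metis sum_mset_sum_list sum_list_sum_nth atLeast0LessThan)+
  have init: "p ! i = q ! i" if "i + 1 < t" for i
    using eq[of "i + 1"] that by (simp add: partition_cuts_def p_def q_def)
  have "p ! i = q ! i" if i: "i < t" for i
  proof (cases "i + 1 < t")
    case False
    then obtain s where s: "t = Suc s" "i = s" using i by (cases t) auto
    have "(\<Sum>j<s. p ! j) = (\<Sum>j<s. q ! j)" using init s by (intro sum.cong) auto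
    then show ?thesis using sum s by simp
  qed (rule init)
  then have "p = q" using len by (intro nth_equalityI) auto
  then show ?thesis using mp by simp
qed

section \<open>Counting inequivalent decompositions\<close>

lemma card_facets_nested:
  fixes A :: "nat \<Rightarrow> 'n::finite set"
  assumes N: "nested_cuts r t A" and r: "r = 2 \<longrightarrow> t = 2" and j: "j \<in> {1..t}"
  shows "card (maximal_proper_faces (base_polytope (slab_bases r (A (j - 1)) (A j)))) +
    facet_deficit (CARD('n)) r t (\<lambda>k. card (A k)) j = 2 * CARD('n) + 2"
proof -
  define n where "n = CARD('n)"
  define a where "a = card (A (j - 1))"
  define b where "b = card (A j)"
  have P: "proper_slab r (A (j - 1)) (A j)" using nested_cuts_proper_slab[OF N] j by simp
  note s = slab_blocks[OF P]
  have m: "2 \<le> r" "2 \<le> t" "A 0 = {}" "A t = UNIV" "2 \<le> card (A 1)" "r \<le> card (- A (t - 1))"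
    using N by (auto simp: nested_cuts_def)
  have compl: "card (- X) = n - card X" for X :: "'n set"
    by (simp add: n_def Compl_eq_Diff_UNIV card_Diff_subset)
  have ab: "a < b" "b \<le> n" unfolding a_def b_def n_def
    using s(2) by (auto intro: psubset_card_mono card_mono)
  have diff: "card (A j - A (j - 1)) = b - a"
    unfolding a_def b_def using s(2) by (intro card_Diff_subset) auto
  have first: "A (j - 1) = {} \<longleftrightarrow> j = 1"
  proof
    assume e: "A (j - 1) = {}"
    show "j = 1"
    proof (rule ccontr)
      assume "j \<noteq> 1"
      then have "A 1 \<subseteq> A (j - 1)" using j by (intro nested_cuts_mono[OF N]) auto
      then show False using e m(5) by auto
    qed
  qed (use m in simp)
  have last: "A j = UNIV \<longleftrightarrow> j = t"
  proof
    assume e: "A j = UNIV"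
    show "j = t"
    proof (rule ccontr)
      assume "j \<noteq> t"
      then have "A j \<subseteq> A (t - 1)" using j by (intro nested_cuts_mono[OF N]) auto
      then have "A (t - 1) = UNIV" using e by blast
      then have "card (- A (t - 1)) = 0" by simp
      then show False using m(1,6) by linarith
    qed
  qed (use m in simp)
  have count: "card (maximal_proper_faces (base_polytope (slab_bases r (A (j - 1)) (A j)))) +
      (if (if j = 1 then 3 else if j = t then r + 1 else 2) \<le> b - a then 0 else b - a) =
      n + (b - a) + (if 3 \<le> r then n - b else 0) + of_bool (j \<noteq> 1) + of_bool (j \<noteq> t)"
    using card_slab_facets[OF P] card_maximal_proper_faces_slab[OF P]
    unfolding roomy_slab_def diff first last compl n_def[symmetric] b_def[symmetric] by simp
  have deficit: "facet_deficit n r t (\<lambda>k. card (A k)) j =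
     (if j = 1 then 1 + 2 * of_bool (b = 2) + of_bool (r = 2) * (n - b)
      else if j < t then a + of_bool (b = a + 1) else a + 1 + r * of_bool (a + r = n))"
    by (auto simp: facet_deficit_def a_def b_def)
  consider "j = 1" | "j \<noteq> 1" "j \<noteq> t" | "j \<noteq> 1" "j = t" by blast
  then have "card (maximal_proper_faces (base_polytope (slab_bases r (A (j - 1)) (A j)))) +
     (if j = 1 then 1 + 2 * of_bool (b = 2) + of_bool (r = 2) * (n - b)
      else if j < t then a + of_bool (b = a + 1) else a + 1 + r * of_bool (a + r = n)) = 2 * n + 2"
  proof cases
    case 1
    then have "a = 0" "2 \<le> b" "j \<noteq> t" using m by (auto simp: a_def b_def)
    then show ?thesis using count 1 ab m(1) by (cases "b = 2"; cases "r = 2") auto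
  next
    case 2
    then have "3 \<le> r" "j < t" using r j m(1) by auto
    then consider "b = a + 1" | "2 \<le> b - a" "b \<noteq> a + 1" using ab by linarith
    then show ?thesis using count 2 ab \<open>3 \<le> r\<close> \<open>j < t\<close> by cases simp_all
  next
    case 3
    then have b: "b = n" using m by (simp add: b_def n_def)
    have "r \<le> n - a" using m(6) 3 by (simp add: a_def compl)
    then consider "n = a + r" | "r + 1 \<le> n - a" "a + r \<noteq> n" using ab by linarith
    then show ?thesis using count 3 ab b by cases auto
  qed
  then show ?thesis unfolding n_def[symmetric] deficit .
qed

lemma nested_cuts_of_sizes:
  assumes c: "cut_sizes (CARD('n::finite)) r t \<alpha>"
  obtains A :: "nat \<Rightarrow> 'n::finite set" where "nested_cuts r t A" "\<And>k. k \<le> t \<Longrightarrow> card (A k) = \<alpha> k"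
proof -
  obtain e where e: "bij_betw e {..<CARD('n)} (UNIV :: 'n set)"
    using ex_bij_betw_nat_finite[of "UNIV :: 'n set"] by (auto simp: atLeast0LessThan)
  define A where "A k = e ` {..<\<alpha> k}" for k
  have m: "2 \<le> r" "2 \<le> t" "\<alpha> 0 = 0" "\<alpha> t = CARD('n)" "2 \<le> \<alpha> 1" "\<alpha> (t - 1) + r \<le> CARD('n)"
    using c by (auto simp: cut_sizes_def)
  have le: "\<alpha> k \<le> CARD('n)" if "k \<le> t" for k
    using cut_sizes_less[OF c, of k t] that m(4) by (cases "k = t") auto
  have card: "card (A k) = \<alpha> k" if "k \<le> t" for k
  proof -
    have "inj_on e {..<\<alpha> k}"
      using e le[OF that] by (auto simp: bij_betw_def intro: inj_on_subset)
    then show ?thesis by (simp add: A_def card_image)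
  qed
  have "A k \<subset> A (Suc k)" if "k < t" for k
  proof -
    have lt: "\<alpha> k < \<alpha> (Suc k)" using cut_sizes_less[OF c, of k "Suc k"] that by simp
    then have "A k \<subseteq> A (Suc k)" by (auto simp: A_def)
    moreover have "card (A k) \<noteq> card (A (Suc k))" using card that lt by simp
    ultimately show ?thesis by auto
  qed
  moreover have "A t = UNIV" using e m by (simp add: A_def bij_betw_def)
  moreover have "r \<le> card (- A (t - 1))"
    using m card[of "t - 1"] by (simp add: Compl_eq_Diff_UNIV card_Diff_subset)
  ultimately have "nested_cuts r t A" using m card[of 1] by (simp add: nested_cuts_def) (simp add: A_def)
  then show thesis using that card by blast
qed

text \<open>The permutation matches slabs with equally many facets, so for every threshold both decompositions
  have the same number of slabs whose deficit reaches it.\<close>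

lemma equivalent_nested_sizes:
  fixes A B :: "nat \<Rightarrow> 'n::finite set"
  assumes A: "nested_cuts r t A" and B: "nested_cuts r t B"
    and sA: "cut_sizes (CARD('n)) r t \<alpha>" "\<And>k. k \<le> t \<Longrightarrow> card (A k) = \<alpha> k"
    and sB: "cut_sizes (CARD('n)) r t \<beta>" "\<And>k. k \<le> t \<Longrightarrow> card (B k) = \<beta> k"
    and \<sigma>: "\<sigma> permutes {1..t}"
    and eqv: "\<And>j. j \<in> {1..t} \<Longrightarrow> combinatorially_equivalent
      (base_polytope (slab_bases r (A (j - 1)) (A j)))
      (base_polytope (slab_bases r (B (\<sigma> j - 1)) (B (\<sigma> j))))"
    and "k \<le> t"
  shows "\<alpha> k = \<beta> k"
proof (rule cut_sizes_determined[OF sA(1) sB(1) _ \<open>k \<le> t\<close>])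
  fix v
  let ?h = "facet_deficit (CARD('n)) r t \<alpha>" and ?g = "facet_deficit (CARD('n)) r t \<beta>"
  have r: "r = 2 \<longrightarrow> t = 2" using sA(1) by (simp add: cut_sizes_def)
  have conv: "convex (base_polytope \<C>)" for \<C> :: "'n set set" by (simp add: base_polytope_def)
  have h: "facet_deficit (CARD('n)) r t (\<lambda>k. card (A k)) j = ?h j"
    "facet_deficit (CARD('n)) r t (\<lambda>k. card (B k)) j = ?g j" if "j \<in> {1..t}" for j
    using that sA(2) sB(2) by (auto simp: facet_deficit_def)
  have \<sigma>t: "\<sigma> j \<in> {1..t}" if "j \<in> {1..t}" for j
    using permutes_in_image[OF \<sigma>] that by simp
  have hg: "?h j = ?g (\<sigma> j)" if j: "j \<in> {1..t}" for j
    using card_facets_nested[OF A r j] card_facets_nested[OF B r \<sigma>t[OF j]]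
      card_maximal_proper_faces_combinatorially_equivalent[OF eqv[OF j] conv conv]
    unfolding h(1)[OF j] h(2)[OF \<sigma>t[OF j]] by linarith
  have "\<sigma> ` {j\<in>{1..t}. v \<le> ?h j} = {j\<in>{1..t}. v \<le> ?g j}"
  proof
    show "\<sigma> ` {j\<in>{1..t}. v \<le> ?h j} \<subseteq> {j\<in>{1..t}. v \<le> ?g j}"
    proof
      fix i assume "i \<in> \<sigma> ` {j\<in>{1..t}. v \<le> ?h j}"
      then obtain j where j: "j \<in> {1..t}" "v \<le> ?h j" "i = \<sigma> j" by blast
      then have "v \<le> ?g i" using hg[OF j(1)] by simp
      then show "i \<in> {j\<in>{1..t}. v \<le> ?g j}" using \<sigma>t[OF j(1)] j(3) by blast
    qed
    show "{j\<in>{1..t}. v \<le> ?g j} \<subseteq> \<sigma> ` {j\<in>{1..t}. v \<le> ?h j}"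
    proof
      fix i assume i: "i \<in> {j\<in>{1..t}. v \<le> ?g j}"
      then obtain j where j: "j \<in> {1..t}" "i = \<sigma> j" using permutes_image[OF \<sigma>] by blast
      then have "v \<le> ?h j" using hg[OF j(1)] i by simp
      then show "i \<in> \<sigma> ` {j\<in>{1..t}. v \<le> ?h j}" using j by blast
    qed
  qed
  moreover have "card (\<sigma> ` {j\<in>{1..t}. v \<le> ?h j}) = card {j\<in>{1..t}. v \<le> ?h j}"
    by (rule card_image, rule inj_on_subset[OF permutes_inj[OF \<sigma>]]) simp
  ultimately show "card {j\<in>{1..t}. v \<le> ?h j} = card {j\<in>{1..t}. v \<le> ?g j}" by simp
qed

lemma card_le_num_base_decompositions:
  assumes D: "\<And>N. N \<in> S \<Longrightarrow> base_decomposition t \<B> (M N)"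
    and inj: "\<And>N N'. N \<in> S \<Longrightarrow> N' \<in> S \<Longrightarrow> (M N, M N') \<in> decomposition_equiv t \<B> \<Longrightarrow> N = N'"
  shows "card S \<le> num_base_decompositions t \<B>"
  unfolding num_base_decompositions_def
proof (rule card_inj_on_le[where f = "\<lambda>N. decomposition_equiv t \<B> `` {M N}"])
  show "inj_on (\<lambda>N. decomposition_equiv t \<B> `` {M N}) S"
    using inj eq_equiv_class[OF _ equiv_decomposition_equiv] D by (intro inj_onI) blast
  show "(\<lambda>N. decomposition_equiv t \<B> `` {M N}) ` S \<subseteq> {M. base_decomposition t \<B> M} // decomposition_equiv t \<B>"
    using D by (auto intro: quotientI)
qed (rule finite_base_decomposition_classes)

text \<open>Dualising every piece of a representative of each class gives pairwise inequivalent decompositions,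
  since a reflected polytope is combinatorially equivalent to the original one.\<close>

lemma num_base_decompositions_dual:
  fixes \<B> :: "'n::finite set set"
  shows "num_base_decompositions t \<B> \<le> num_base_decompositions t (uminus ` \<B>)"
proof -
  define M where "M C = (SOME M. M \<in> C)" for C :: "(nat \<Rightarrow> 'n set set) set"
  let ?Q = "{M. base_decomposition t \<B> M} // decomposition_equiv t \<B>"
  let ?D = "\<lambda>M. \<lambda>i\<in>{1..t}. uminus ` M i"
  have MC: "M C \<in> C" if "C \<in> ?Q" for C
    using in_quotient_imp_non_empty[OF equiv_decomposition_equiv that] by (simp add: M_def some_in_eq)
  have dec: "base_decomposition t \<B> (M C)" if "C \<in> ?Q" for C
    using MC[OF that] in_quotient_imp_subset[OF equiv_decomposition_equiv that] by blast
  have "card ?Q \<le> num_base_decompositions t (uminus ` \<B>)"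
  proof (rule card_le_num_base_decompositions[where M = "\<lambda>C. ?D (M C)"])
    show "base_decomposition t (uminus ` \<B>) (?D (M C))" if "C \<in> ?Q" for C
      using base_decomposition_dual[OF dec[OF that]] .
    fix C C' assume C: "C \<in> ?Q" "C' \<in> ?Q"
      and "(?D (M C), ?D (M C')) \<in> decomposition_equiv t (uminus ` \<B>)"
    then obtain \<sigma> where \<sigma>: "\<sigma> permutes {1..t}" and eqv: "\<And>i. i \<in> {1..t} \<Longrightarrow>
        combinatorially_equivalent (base_polytope (?D (M C) i)) (base_polytope (?D (M C') (\<sigma> i)))"
      unfolding decomposition_equiv_def by blast
    have refl: "combinatorially_equivalent (base_polytope \<C>) (base_polytope (uminus ` \<C>))" for \<C> :: "'n set set"
      unfolding base_polytope_dual by (rule combinatorially_equivalent_reflection)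
    have "combinatorially_equivalent (base_polytope (M C i)) (base_polytope (M C' (\<sigma> i)))"
      if i: "i \<in> {1..t}" for i
    proof -
      have "\<sigma> i \<in> {1..t}" using permutes_in_image[OF \<sigma>] i by simp
      then have "combinatorially_equivalent (base_polytope (uminus ` M C i)) (base_polytope (uminus ` M C' (\<sigma> i)))"
        using eqv[OF i] i by simp
      then show ?thesis
        by (meson refl combinatorially_equivalent_sym combinatorially_equivalent_trans)
    qed
    then have "(M C, M C') \<in> decomposition_equiv t \<B>"
      unfolding decomposition_equiv_def using \<sigma> dec C by blast
    then show "C = C'"
      using quotient_eqI[OF equiv_decomposition_equiv C MC[OF C(1)] MC[OF C(2)]] by simp
  qed
  then show ?thesis by (simp add: num_base_decompositions_def)
qed

lemma num_partitions_le_num_base_decompositions: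
  assumes t: "2 \<le> t" "t \<le> r" and r: "2 * r \<le> CARD('n::finite)"
  shows "num_partitions_ge2 t (CARD('n)) \<le> num_base_decompositions t (uniform_bases (UNIV :: 'n::finite set) r)"
proof -
  let ?S = "{N :: nat multiset. size N = t \<and> (\<forall>p\<in>#N. 2 \<le> p) \<and> sum_mset N = CARD('n)}"
  let ?\<alpha> = "partition_cuts (CARD('n)) t"
  have sizes: "cut_sizes (CARD('n)) r t (?\<alpha> N)" if "N \<in> ?S" for N
    using that t r by (intro cut_sizes_partition) auto
  have "\<exists>A :: nat \<Rightarrow> 'n set. nested_cuts r t A \<and> (\<forall>k\<le>t. card (A k) = ?\<alpha> N k)" if "N \<in> ?S" for N
    by (rule nested_cuts_of_sizes[OF sizes[OF that]]) blast
  then have "\<forall>N\<in>?S. \<exists>A :: nat \<Rightarrow> 'n set. nested_cuts r t A \<and> (\<forall>k\<le>t. card (A k) = ?\<alpha> N k)" by blast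
  from bchoice[OF this] obtain A :: "nat multiset \<Rightarrow> nat \<Rightarrow> 'n set"
    where A: "\<forall>N\<in>?S. nested_cuts r t (A N) \<and> (\<forall>k\<le>t. card (A N k) = ?\<alpha> N k)" by (elim exE)
  have nested: "nested_cuts r t (A N)" if "N \<in> ?S" for N using bspec[OF A that] by simp
  have card_A: "card (A N k) = ?\<alpha> N k" if "N \<in> ?S" "k \<le> t" for N k using bspec[OF A that(1)] that(2) by simp
  define M where "M N = (\<lambda>j\<in>{1..t}. slab_bases r (A N (j - 1)) (A N j))" for N
  have "card ?S \<le> num_base_decompositions t (uniform_bases (UNIV :: 'n set) r)"
  proof (rule card_le_num_base_decompositions[where M = M])
    show "base_decomposition t (uniform_bases UNIV r) (M N)" if "N \<in> ?S" for N
      unfolding M_def by (rule base_decomposition_nested[OF nested[OF that]])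
    fix N N' assume N: "N \<in> ?S" and N': "N' \<in> ?S"
      and "(M N, M N') \<in> decomposition_equiv t (uniform_bases UNIV r)"
    then obtain \<sigma> where \<sigma>: "\<sigma> permutes {1..t}" and eqv: "\<And>i. i \<in> {1..t} \<Longrightarrow>
        combinatorially_equivalent (base_polytope (M N i)) (base_polytope (M N' (\<sigma> i)))"
      unfolding decomposition_equiv_def by blast
    have "?\<alpha> N k = ?\<alpha> N' k" if "k \<le> t" for k
    proof (rule equivalent_nested_sizes[OF nested[OF N] nested[OF N'] sizes[OF N] _ sizes[OF N'] _ \<sigma> _ that])
      show "card (A N i) = ?\<alpha> N i" "card (A N' i) = ?\<alpha> N' i" if "i \<le> t" for i
        using card_A[OF N that] card_A[OF N' that] by simp_all
      show "combinatorially_equivalent (base_polytope (slab_bases r (A N (j - 1)) (A N j)))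
          (base_polytope (slab_bases r (A N' (\<sigma> j - 1)) (A N' (\<sigma> j))))" if j: "j \<in> {1..t}" for j
      proof -
        have "\<sigma> j \<in> {1..t}" using permutes_in_image[OF \<sigma>] j by simp
        then show ?thesis using eqv[OF j] j by (simp add: M_def)
      qed
    qed
    then show "N = N'" using N N' by (intro partition_cuts_inject[of N t "CARD('n)" N']) auto
  qed
  then show ?thesis by (simp add: num_partitions_ge2_def)
qed

theorem corollary1:
  fixes n r t :: nat
  assumes "CARD('n::finite) = n"
    and "n \<ge> 2" and "r \<ge> 2" and "t \<ge> 2"
    and "n \<ge> r + t" and "r \<ge> t"
  shows "num_base_decompositions t (uniform_bases (UNIV :: 'n set) r) \<ge> num_partitions_ge2 t n"
proof (cases "2 * r \<le> n")
  case True
  then show ?thesis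
    using num_partitions_le_num_base_decompositions[of t r, where 'n = 'n] assms by simp
next
  case False
  have "num_partitions_ge2 t n \<le> num_base_decompositions t (uniform_bases (UNIV :: 'n set) (n - r))"
    using num_partitions_le_num_base_decompositions[of t "n - r", where 'n = 'n] assms False by simp
  also have "\<dots> \<le> num_base_decompositions t (uminus ` uniform_bases (UNIV :: 'n set) (n - r))"
    by (rule num_base_decompositions_dual)
  also have "uminus ` uniform_bases (UNIV :: 'n set) (n - r) = uniform_bases UNIV r"
    using uniform_bases_dual[of "n - r", where 'n = 'n] assms by simp
  finally show ?thesis .
qed

end
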